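(* Let $Q$ be a smooth manifold, $M\subset TQ$ a submanifold projecting onto $Q$, and $\Gamma$ a SODE on $M$. If $\Gamma$ is variational, then there exists (locally, i.e. on some open neighbourhood $U$ in $TQ$ of each point of $M$) a Lagrangian $L:TQ\supseteq U\to\mathbb{R}$ such that the integral curves of $\Gamma$ are the restriction to $M$ of the solutions of the Euler–Lagrange equations of $L$; that is, for a curve $c$ in $Q$ whose velocity curve $\dot c$ lies in $M\cap U$, $\dot c$ is an integral curve of $\Gamma$ if and only if $c$ satisfies $\frac{d}{dt}\left(\frac{\partial L}{\partial\dot q^i}\right)-\frac{\partial L}{\partial q^i}=0$ for all $i$.
   Context: Everything is smooth. $n=\dim Q$, $\tau_Q:TQ\to Q$ and $\pi_Q:T^*Q\to Q$ are the canonical projections, with coordinates $(q^i,\dot q^i)$ on $TQ$ and $(q^i,p_i)$ on $T^*Q$. The Lagrangian $L$ is not required to be regular. Standing assumption on $M$: $\tau_Q(M)=Q$, and locally $M$ is given by constraints $\dot q^\alpha=\psi^\alpha(q^i,\dot q^a)$, $1\le\alpha\le m$, where the velocities are split as $(\dot q^a,\dot q^\alpha)$, so that $(q^i,\dot q^a)$, $1\le i\le n$, $1\le a\le n-m$, are local coordinates on $M$ (in particular $\tau_Q|_M$ is a submersion). SODE on $M$: a vector field $\Gamma$ on $M$ (tangent to $M$) with $S_x(\Gamma(x))=\Delta(x)$ for all $x\in M$, where $S=dq^i\otimes\frac{\partial}{\partial\dot q^i}$ and $\Delta=\dot q^i\frac{\partial}{\partial\dot q^i}$; its integral curves are velocity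 curves of curves in $Q$ satisfying $\ddot q^a=\Gamma^a(q^i,\dot q^b)$, $\dot q^\alpha=\psi^\alpha(q^i,\dot q^b)$. Tulczyjew isomorphism: $\alpha_Q:TT^*Q\to T^*TQ$, in induced coordinates $\alpha_Q(q^i,p_i,\dot q^i,\dot p_i)=(q^i,\dot q^i,\dot p_i,p_i)$, i.e. the covector $\dot p_i\,dq^i+p_i\,d\dot q^i$ at $(q^i,\dot q^i)\in TQ$. $\omega_{TQ}$ is the canonical symplectic form on $T^*TQ$; a submanifold is isotropic if $\omega_{TQ}$ pulls back to zero on it. Variational (constrained): the SODE $\Gamma$ on $M$ is variational if (locally around each point of $M$) there exists an immersion $F:M\to T^*Q$ over $Q$ (i.e. $\pi_Q\circ F=\tau_Q|_M$) such that $\mathrm{Im}(\mu_{\Gamma,F})$ is an isotropic submanifold of $(T^*TQ,\omega_{TQ})$, where $\mu_{\Gamma,F}=\alpha_Q\circ TF\circ\Gamma$. *)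

theory Defs
  imports "HOL-Analysis.Analysis"
begin

section \<open>Smooth maps between Euclidean spaces\<close>

text \<open>Only meaningful for open \<open>S\<close>; all uses below are on open sets.\<close>

primrec Ck_on :: "nat \<Rightarrow> 'a::real_normed_vector set \<Rightarrow> ('a \<Rightarrow> 'b::real_normed_vector) \<Rightarrow> bool" where
  "Ck_on 0 S f \<longleftrightarrow> continuous_on S f"
| "Ck_on (Suc k) S f \<longleftrightarrow>
     (\<forall>x\<in>S. f differentiable (at x)) \<and> (\<forall>v. Ck_on k S (\<lambda>x. frechet_derivative f (at x) v))"

definition smooth_on :: "'a::real_normed_vector set \<Rightarrow> ('a \<Rightarrow> 'b::real_normed_vector) \<Rightarrow> bool" where
  "smooth_on S f \<longleftrightarrow> (\<forall>k. Ck_on k S f)"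


section \<open>Manifolds\<close>

text \<open>An atlas is a family of charts indexed by a whole type (\<open>cdom i\<close> may be empty).
  Keeping the index, rather than a set of charts, lets the induced atlases of \<open>TQ\<close>, \<open>T\<^sup>*Q\<close>,
  \<open>TT\<^sup>*Q\<close>, \dots be indexed by the same type as the atlas of \<open>Q\<close>.\<close>

record ('a, 'i, 'e) atlas =
  cdom :: "'i \<Rightarrow> 'a set"
  chart :: "'i \<Rightarrow> 'a \<Rightarrow> 'e"

definition carrier :: "('a, 'i, 'e) atlas \<Rightarrow> 'a set" where
  "carrier A = (\<Union>i. cdom A i)"

definition chart_inv :: "('a, 'i, 'e) atlas \<Rightarrow> 'i \<Rightarrow> 'e \<Rightarrow> 'a" where
  "chart_inv A i = inv_into (cdom A i) (chart A i)"

definition transition :: "('a, 'i, 'e) atlas \<Rightarrow> 'i \<Rightarrow> 'i \<Rightarrow> 'e \<Rightarrow> 'e" where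
  "transition A i j = chart A j \<circ> chart_inv A i"

definition mtopology :: "('a, 'i, 'e::euclidean_space) atlas \<Rightarrow> 'a topology" where
  "mtopology A =
     topology (\<lambda>U. U \<subseteq> carrier A \<and> (\<forall>i. open (chart A i ` (U \<inter> cdom A i))))"

definition smooth_manifold :: "('a, 'i, 'e::euclidean_space) atlas \<Rightarrow> bool" where
  "smooth_manifold A \<longleftrightarrow>
     (\<forall>i. inj_on (chart A i) (cdom A i)) \<and>
     (\<forall>i j. open (chart A i ` (cdom A i \<inter> cdom A j))) \<and>
     (\<forall>i j. smooth_on (chart A i ` (cdom A i \<inter> cdom A j)) (transition A i j)) \<and>
     Hausdorff_space (mtopology A) \<and> second_countable (mtopology A)"

text \<open>The predicate defining \<open>mtopology\<close> really is a topology.\<close>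

lemma openin_mtopology:
  assumes inj: "\<And>i. inj_on (chart A i) (cdom A i)"
  shows "openin (mtopology A) U \<longleftrightarrow>
           U \<subseteq> carrier A \<and> (\<forall>i. open (chart A i ` (U \<inter> cdom A i)))"
proof -
  have "istopology (\<lambda>U. U \<subseteq> carrier A \<and> (\<forall>i. open (chart A i ` (U \<inter> cdom A i))))"
    unfolding istopology_def
  proof (intro conjI allI impI; (elim conjE)?)
    fix S T i
    assume "\<forall>i. open (chart A i ` (S \<inter> cdom A i))" "\<forall>i. open (chart A i ` (T \<inter> cdom A i))"
    moreover have "chart A i ` (S \<inter> T \<inter> cdom A i) =
        chart A i ` (S \<inter> cdom A i) \<inter> chart A i ` (T \<inter> cdom A i)"
      using inj[of i] by (auto simp: inj_on_def)
    ultimately show "open (chart A i ` (S \<inter> T \<inter> cdom A i))" by auto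
  next
    fix K i
    assume "\<forall>S\<in>K. S \<subseteq> carrier A \<and> (\<forall>i. open (chart A i ` (S \<inter> cdom A i)))"
    moreover have "chart A i ` (\<Union>K \<inter> cdom A i) = (\<Union>S\<in>K. chart A i ` (S \<inter> cdom A i))"
      by auto
    ultimately show "open (chart A i ` (\<Union>K \<inter> cdom A i))" by auto
  qed auto
  then show ?thesis
    unfolding mtopology_def by (simp add: topology_inverse')
qed


section \<open>Tangent and cotangent bundles\<close>

text \<open>A tangent vector at \<open>p\<close> is the family of its components in all charts around \<open>p\<close>, with the
  usual transformation law (and \<open>0\<close> for charts not containing \<open>p\<close>). Covectors likewise, the
  component \<open>\<lambda> i\<close> standing for the linear form \<open>w \<mapsto> \<lambda> i \<bullet> w\<close>.\<close>

definition tangent_vectors ::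
    "('a, 'i, 'e::euclidean_space) atlas \<Rightarrow> 'a \<Rightarrow> ('i \<Rightarrow> 'e) set" where
  "tangent_vectors A p = {v.
     (\<forall>i. p \<notin> cdom A i \<longrightarrow> v i = 0) \<and>
     (\<forall>i j. p \<in> cdom A i \<longrightarrow> p \<in> cdom A j \<longrightarrow>
        v j = frechet_derivative (transition A i j) (at (chart A i p)) (v i))}"

definition cotangent_vectors ::
    "('a, 'i, 'e::euclidean_space) atlas \<Rightarrow> 'a \<Rightarrow> ('i \<Rightarrow> 'e) set" where
  "cotangent_vectors A p = {l.
     (\<forall>i. p \<notin> cdom A i \<longrightarrow> l i = 0) \<and>
     (\<forall>i j. p \<in> cdom A i \<longrightarrow> p \<in> cdom A j \<longrightarrow>
        (\<forall>w. l i \<bullet> w = l j \<bullet> frechet_derivative (transition A i j) (at (chart A i p)) w))}"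

text \<open>Charts \<open>(q, dq/dt)\<close> on \<open>TQ\<close> and \<open>(q, p)\<close> on \<open>T\<^sup>*Q\<close>. The bundle projections are \<open>fst\<close>.\<close>

definition TB :: "('a, 'i, 'e::euclidean_space) atlas \<Rightarrow> ('a \<times> ('i \<Rightarrow> 'e), 'i, 'e \<times> 'e) atlas" where
  "TB A = \<lparr> cdom = (\<lambda>i. {(p, v). p \<in> cdom A i \<and> v \<in> tangent_vectors A p}),
            chart = (\<lambda>i (p, v). (chart A i p, v i)) \<rparr>"

definition CB :: "('a, 'i, 'e::euclidean_space) atlas \<Rightarrow> ('a \<times> ('i \<Rightarrow> 'e), 'i, 'e \<times> 'e) atlas" where
  "CB A = \<lparr> cdom = (\<lambda>i. {(p, l). p \<in> cdom A i \<and> l \<in> cotangent_vectors A p}),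
            chart = (\<lambda>i (p, l). (chart A i p, l i)) \<rparr>"


section \<open>Curves, submanifolds and smooth maps on them\<close>

definition smooth_curve ::
    "('a, 'i, 'e::euclidean_space) atlas \<Rightarrow> real set \<Rightarrow> (real \<Rightarrow> 'a) \<Rightarrow> bool" where
  "smooth_curve A J c \<longleftrightarrow> c ` J \<subseteq> carrier A \<and>
     (\<forall>i. open {t\<in>J. c t \<in> cdom A i} \<and> smooth_on {t\<in>J. c t \<in> cdom A i} (chart A i \<circ> c))"

definition velocity ::
    "('a, 'i, 'e::euclidean_space) atlas \<Rightarrow> (real \<Rightarrow> 'a) \<Rightarrow> real \<Rightarrow> 'a \<times> ('i \<Rightarrow> 'e)" where
  "velocity A c t =
     (c t, \<lambda>i. if c t \<in> cdom A i then vector_derivative (chart A i \<circ> c) (at t) else 0)"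

text \<open>Embedded \<open>k\<close>-dimensional submanifolds, by slice charts \<open>\<phi> \<circ> chart A i\<close>.\<close>

definition submanifold ::
    "('a, 'i, 'e::euclidean_space) atlas \<Rightarrow> nat \<Rightarrow> 'a set \<Rightarrow> bool" where
  "submanifold A k X \<longleftrightarrow> X \<subseteq> carrier A \<and>
     (\<forall>x\<in>X. \<exists>i W (\<phi> :: 'e \<Rightarrow> 'e) V.
        x \<in> cdom A i \<and> open W \<and> chart A i x \<in> W \<and> W \<subseteq> chart A i ` cdom A i \<and>
        inj_on \<phi> W \<and> smooth_on W \<phi> \<and> open (\<phi> ` W) \<and> smooth_on (\<phi> ` W) (inv_into W \<phi>) \<and>
        subspace V \<and> dim V = k \<and>
        \<phi> ` (chart A i ` (X \<inter> cdom A i) \<inter> W) = \<phi> ` W \<inter> V)"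

definition germ_curve_in ::
    "('a, 'i, 'e::euclidean_space) atlas \<Rightarrow> 'a set \<Rightarrow> (real \<Rightarrow> 'a) \<Rightarrow> bool" where
  "germ_curve_in A X g \<longleftrightarrow>
     (\<exists>\<epsilon>>0. smooth_curve A {-\<epsilon><..<\<epsilon>} g \<and> g ` {-\<epsilon><..<\<epsilon>} \<subseteq> X)"

text \<open>\<open>T\<^sub>xX\<close> for a submanifold \<open>X\<close> of \<open>A\<close>, as a subset of the fibre of \<open>TB A\<close> over \<open>x\<close>.\<close>

definition tangent_space ::
    "('a, 'i, 'e::euclidean_space) atlas \<Rightarrow> 'a set \<Rightarrow> 'a \<Rightarrow> ('a \<times> ('i \<Rightarrow> 'e)) set" where
  "tangent_space A X x = {velocity A g 0 | g. germ_curve_in A X g \<and> g 0 = x}"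

text \<open>A map on a submanifold is smooth if it locally extends smoothly to the ambient manifold.\<close>

definition smooth_map_on ::
    "('a, 'i, 'e::euclidean_space) atlas \<Rightarrow> 'a set \<Rightarrow> ('b, 'j, 'f::euclidean_space) atlas
      \<Rightarrow> ('a \<Rightarrow> 'b) \<Rightarrow> bool" where
  "smooth_map_on A X B f \<longleftrightarrow> f ` X \<subseteq> carrier B \<and>
     (\<forall>x\<in>X. \<forall>i j. x \<in> cdom A i \<longrightarrow> f x \<in> cdom B j \<longrightarrow>
        (\<exists>W g. open W \<and> chart A i x \<in> W \<and> W \<subseteq> chart A i ` cdom A i \<and> smooth_on W g \<and>
           (\<forall>y\<in>X \<inter> cdom A i. chart A i y \<in> W \<longrightarrow>
              f y \<in> cdom B j \<and> chart B j (f y) = g (chart A i y))))"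

text \<open>\<open>Tf : TX \<rightarrow> TB\<close> for \<open>f\<close> smooth on the submanifold \<open>X\<close>: it sends the velocity of a curve
  \<open>g\<close> in \<open>X\<close> to the velocity of \<open>f \<circ> g\<close>.\<close>

definition tangent_map ::
    "('a, 'i, 'e::euclidean_space) atlas \<Rightarrow> 'a set \<Rightarrow> ('b, 'j, 'f::euclidean_space) atlas
      \<Rightarrow> ('a \<Rightarrow> 'b) \<Rightarrow> 'a \<times> ('i \<Rightarrow> 'e) \<Rightarrow> 'b \<times> ('j \<Rightarrow> 'f)" where
  "tangent_map A X B f w =
     (THE z. \<exists>g. germ_curve_in A X g \<and> velocity A g 0 = w \<and> z = velocity B (f \<circ> g) 0)"

definition immersion_on ::
    "('a, 'i, 'e::euclidean_space) atlas \<Rightarrow> 'a set \<Rightarrow> ('b, 'j, 'f::euclidean_space) atlas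
      \<Rightarrow> ('a \<Rightarrow> 'b) \<Rightarrow> bool" where
  "immersion_on A X B f \<longleftrightarrow> smooth_map_on A X B f \<and>
     (\<forall>x\<in>X. inj_on (tangent_map A X B f) (tangent_space A X x))"

definition smooth_function_on ::
    "('a, 'i, 'e::euclidean_space) atlas \<Rightarrow> 'a set \<Rightarrow> ('a \<Rightarrow> real) \<Rightarrow> bool" where
  "smooth_function_on A U f \<longleftrightarrow>
     (\<forall>i. smooth_on (chart A i ` (U \<inter> cdom A i)) (f \<circ> chart_inv A i))"

definition vector_field_on ::
    "('a, 'i, 'e::euclidean_space) atlas \<Rightarrow> 'a set \<Rightarrow> ('a \<Rightarrow> 'a \<times> ('i \<Rightarrow> 'e)) \<Rightarrow> bool" where
  "vector_field_on A X \<Gamma> \<longleftrightarrow> smooth_map_on A X (TB A) \<Gamma> \<and> (\<forall>x\<in>X. \<Gamma> x \<in> tangent_space A X x)"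

definition integral_curve ::
    "('a, 'i, 'e::euclidean_space) atlas \<Rightarrow> 'a set \<Rightarrow> ('a \<Rightarrow> 'a \<times> ('i \<Rightarrow> 'e))
      \<Rightarrow> real set \<Rightarrow> (real \<Rightarrow> 'a) \<Rightarrow> bool" where
  "integral_curve A X \<Gamma> J g \<longleftrightarrow>
     smooth_curve A J g \<and> g ` J \<subseteq> X \<and> (\<forall>t\<in>J. velocity A g t = \<Gamma> (g t))"


section \<open>The constraint submanifold and SODEs on it\<close>

text \<open>Locally \<open>M\<close> is given by \<open>dq\<^sup>\<alpha>/dt = \<psi>\<^sup>\<alpha>(q, dq\<^sup>a/dt)\<close>, \<open>\<alpha>\<close> running over \<open>m\<close> of the coordinates
  (the set \<open>B\<close> of basis vectors) and \<open>a\<close> over the others; the sum below is the vector with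
  coordinates \<open>dq\<^sup>a/dt\<close> and \<open>0\<close> in place of \<open>dq\<^sup>\<alpha>/dt\<close>.\<close>

definition locally_constraints ::
    "('a, 'i, 'e::euclidean_space) atlas \<Rightarrow> nat \<Rightarrow> ('a \<times> ('i \<Rightarrow> 'e)) set \<Rightarrow> bool" where
  "locally_constraints Q m M \<longleftrightarrow>
     (\<forall>x\<in>M. \<exists>i W B D (\<psi> :: 'e \<Rightarrow> 'e \<times> 'e \<Rightarrow> real).
        x \<in> cdom (TB Q) i \<and> open W \<and> chart (TB Q) i x \<in> W \<and>
        W \<subseteq> chart (TB Q) i ` cdom (TB Q) i \<and>
        B \<subseteq> Basis \<and> card B = m \<and> open D \<and> (\<forall>\<alpha>\<in>B. smooth_on D (\<psi> \<alpha>)) \<and>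
        (\<forall>(q, v)\<in>W. (q, \<Sum>a\<in>Basis - B. (v \<bullet> a) *\<^sub>R a) \<in> D) \<and>
        chart (TB Q) i ` (M \<inter> cdom (TB Q) i) \<inter> W =
          {(q, v). (q, v) \<in> W \<and>
             (\<forall>\<alpha>\<in>B. v \<bullet> \<alpha> = \<psi> \<alpha> (q, \<Sum>a\<in>Basis - B. (v \<bullet> a) *\<^sub>R a))})"

definition constraint_submanifold ::
    "('a, 'i, 'e::euclidean_space) atlas \<Rightarrow> nat \<Rightarrow> ('a \<times> ('i \<Rightarrow> 'e)) set \<Rightarrow> bool" where
  "constraint_submanifold Q m M \<longleftrightarrow>
     submanifold (TB Q) (2 * DIM('e) - m) M \<and> fst ` M = carrier Q \<and> locally_constraints Q m M"

text \<open>\<open>S = dq\<^sup>i \<otimes> \<partial>/\<partial>(dq\<^sup>i/dt)\<close> and \<open>\<Delta> = (dq\<^sup>i/dt) \<partial>/\<partial>(dq\<^sup>i/dt)\<close> in the induced charts.\<close>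

definition vertical_endomorphism ::
    "('a \<times> ('i \<Rightarrow> 'e)) \<times> ('i \<Rightarrow> 'e::euclidean_space \<times> 'e)
      \<Rightarrow> ('a \<times> ('i \<Rightarrow> 'e)) \<times> ('i \<Rightarrow> 'e \<times> 'e)" where
  "vertical_endomorphism w = (fst w, \<lambda>i. (0, fst (snd w i)))"

definition liouville_field ::
    "'a \<times> ('i \<Rightarrow> 'e::euclidean_space) \<Rightarrow> ('a \<times> ('i \<Rightarrow> 'e)) \<times> ('i \<Rightarrow> 'e \<times> 'e)" where
  "liouville_field x = (x, \<lambda>i. (0, snd x i))"

definition SODE_on ::
    "('a, 'i, 'e::euclidean_space) atlas \<Rightarrow> ('a \<times> ('i \<Rightarrow> 'e)) set
      \<Rightarrow> ('a \<times> ('i \<Rightarrow> 'e) \<Rightarrow> ('a \<times> ('i \<Rightarrow> 'e)) \<times> ('i \<Rightarrow> 'e \<times> 'e)) \<Rightarrow> bool" where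
  "SODE_on Q M \<Gamma> \<longleftrightarrow>
     vector_field_on (TB Q) M \<Gamma> \<and>
     (\<forall>x\<in>M. vertical_endomorphism (\<Gamma> x) = liouville_field x)"


section \<open>Variational SODEs\<close>

text \<open>\<open>\<alpha>\<^sub>Q : TT\<^sup>*Q \<rightarrow> T\<^sup>*TQ\<close>. In every chart, \<open>((q, p), (dq, dp)) \<mapsto> ((q, dq), (dp, p))\<close>.\<close>

definition tulczyjew ::
    "('a \<times> ('i \<Rightarrow> 'e)) \<times> ('i \<Rightarrow> 'e::euclidean_space \<times> 'e)
      \<Rightarrow> ('a \<times> ('i \<Rightarrow> 'e)) \<times> ('i \<Rightarrow> 'e \<times> 'e)" where
  "tulczyjew = (\<lambda>((x, p), w). ((x, \<lambda>i. fst (w i)), \<lambda>i. (snd (w i), p i)))"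

text \<open>The canonical symplectic form \<open>dq\<^sup>i \<and> dp\<^sub>i\<close> of \<open>T\<^sup>*N\<close> on two tangent vectors at the same point.
  The value does not depend on the chart that is used.\<close>

definition symplectic_form ::
    "('a, 'i, 'e::euclidean_space) atlas \<Rightarrow> ('a \<times> ('i \<Rightarrow> 'e)) \<times> ('i \<Rightarrow> 'e \<times> 'e)
      \<Rightarrow> ('a \<times> ('i \<Rightarrow> 'e)) \<times> ('i \<Rightarrow> 'e \<times> 'e) \<Rightarrow> real" where
  "symplectic_form N u w =
     (let i = (SOME i. fst u \<in> cdom (CB N) i)
      in fst (snd u i) \<bullet> snd (snd w i) - snd (snd u i) \<bullet> fst (snd w i))"

definition isotropic_submanifold ::
    "('a, 'i, 'e::euclidean_space) atlas \<Rightarrow> ('a \<times> ('i \<Rightarrow> 'e)) set \<Rightarrow> bool" where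
  "isotropic_submanifold N Y \<longleftrightarrow>
     (\<exists>k. submanifold (CB N) k Y) \<and>
     (\<forall>y\<in>Y. \<forall>u\<in>tangent_space (CB N) Y y. \<forall>w\<in>tangent_space (CB N) Y y.
        symplectic_form N u w = 0)"

text \<open>\<open>\<mu> = \<alpha>\<^sub>Q \<circ> TF \<circ> \<Gamma>\<close> for \<open>F : X \<rightarrow> T\<^sup>*Q\<close>, \<open>X\<close> an open subset of \<open>M\<close>.\<close>

definition mu ::
    "('a, 'i, 'e::euclidean_space) atlas \<Rightarrow> ('a \<times> ('i \<Rightarrow> 'e)) set
      \<Rightarrow> ('a \<times> ('i \<Rightarrow> 'e) \<Rightarrow> ('a \<times> ('i \<Rightarrow> 'e)) \<times> ('i \<Rightarrow> 'e \<times> 'e))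
      \<Rightarrow> ('a \<times> ('i \<Rightarrow> 'e) \<Rightarrow> 'a \<times> ('i \<Rightarrow> 'e))
      \<Rightarrow> 'a \<times> ('i \<Rightarrow> 'e) \<Rightarrow> ('a \<times> ('i \<Rightarrow> 'e)) \<times> ('i \<Rightarrow> 'e \<times> 'e)" where
  "mu Q X \<Gamma> F = tulczyjew \<circ> tangent_map (TB Q) X (CB Q) F \<circ> \<Gamma>"

definition variational ::
    "('a, 'i, 'e::euclidean_space) atlas \<Rightarrow> ('a \<times> ('i \<Rightarrow> 'e)) set
      \<Rightarrow> ('a \<times> ('i \<Rightarrow> 'e) \<Rightarrow> ('a \<times> ('i \<Rightarrow> 'e)) \<times> ('i \<Rightarrow> 'e \<times> 'e)) \<Rightarrow> bool" where
  "variational Q M \<Gamma> \<longleftrightarrow>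
     (\<forall>x\<in>M. \<exists>W F. openin (mtopology (TB Q)) W \<and> x \<in> W \<and>
        immersion_on (TB Q) (M \<inter> W) (CB Q) F \<and>
        (\<forall>y\<in>M \<inter> W. fst (F y) = fst y) \<and>
        isotropic_submanifold (TB Q) (mu Q (M \<inter> W) \<Gamma> F ` (M \<inter> W)))"


section \<open>Euler--Lagrange equations\<close>

text \<open>\<open>d/dt (\<partial>L/\<partial>(dq\<^sup>b/dt)) = \<partial>L/\<partial>q\<^sup>b\<close> along \<open>c\<close>, for all coordinates \<open>b\<close>, in every chart of \<open>Q\<close>.\<close>

definition euler_lagrange ::
    "('a, 'i, 'e::euclidean_space) atlas \<Rightarrow> ('a \<times> ('i \<Rightarrow> 'e) \<Rightarrow> real)
      \<Rightarrow> real set \<Rightarrow> (real \<Rightarrow> 'a) \<Rightarrow> bool" where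
  "euler_lagrange Q L J c \<longleftrightarrow>
     (\<forall>t\<in>J. \<forall>i. c t \<in> cdom Q i \<longrightarrow> (\<forall>b\<in>Basis.
        let dL = (\<lambda>s. frechet_derivative (L \<circ> chart_inv (TB Q) i)
                        (at (chart (TB Q) i (velocity Q c s))))
        in ((\<lambda>s. dL s (0, b)) has_real_derivative dL t (b, 0)) (at t)))"

end

theory Submission
  imports Defs
begin

text \<open>
  Write \<open>\<mu>\<close> as \<open>y \<mapsto> (y, \<theta> y)\<close>; that it is a section uses the SODE condition. Isotropy of its image
  says that the pullback of \<open>\<theta>\<close> to \<open>M\<close> is closed. With a local retraction \<open>R\<close> onto \<open>M\<close>, read off from a
  slice chart, \<open>R\<^sup>*\<theta>\<close> is closed on a ball, hence equal to \<open>df\<close>, and \<open>L(z) = f(z) + \<theta>(R z) \<bullet> (z - R z)\<close>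
  satisfies \<open>dL = \<theta>\<close> as covectors of \<open>TQ\<close> at the points of \<open>M\<close>. Since \<open>\<theta>\<close> has the components
  \<open>(dp, p)\<close> of \<open>TF \<circ> \<Gamma>\<close>, the Euler--Lagrange equations for a curve \<open>c\<close> with velocity in \<open>M\<close>
  say that \<open>TF\<close> takes the same value on the velocity of \<open>c'\<close> and on \<open>\<Gamma>\<close>, and \<open>F\<close> is an immersion.
\<close>


section \<open>Calculus of smooth maps\<close>

text \<open>The obstacle is that \<theta> is defined on \<open>M\<close> only, while the
  Euler--Lagrange equations contain the derivatives of \<open>L\<close> in all directions of
  \<open>TQ\<close>, also those transverse to \<open>M\<close>. A primitive of the pulled-back form
  fixes \<open>dL\<close> on the tangent directions of \<open>M\<close> only. The correction term,
  linear in the displacement \<open>z - R z\<close>, prescribes the remaining directions at the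
  points of \<open>M\<close>, where it vanishes itself. Nothing more about \<open>L\<close> is
  needed: along a curve with velocity in \<open>M\<close> the equations read \<open>dL\<close> at
  points of \<open>M\<close> alone, so \<open>L\<close> need not be regular, and its behaviour off
  \<open>M\<close> is arbitrary. Pulling back by \<open>R\<close> also replaces calculus on a
  submanifold by calculus on an open set of coordinates. There closedness of the pulled-back form
  reduces to the vanishing of the symplectic form on two tangent vectors of the image, together with
  the symmetry of second derivatives.\<close>

lemma has_frechet_derivative:
  "f differentiable (at x) \<Longrightarrow> (f has_derivative frechet_derivative f (at x)) (at x)"
  by (simp add: frechet_derivative_works)

lemma frechet_derivative_eq: "(f has_derivative f') (at x) \<Longrightarrow> frechet_derivative f (at x) = f'"
  by (rule frechet_derivative_at[symmetric])

lemma frechet_derivative_cong_open: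
  assumes "open S" "x \<in> S" "\<And>y. y \<in> S \<Longrightarrow> f y = g y"
  shows "frechet_derivative f (at x) = frechet_derivative g (at x)"
proof -
  have "(f has_derivative f') (at x) \<longleftrightarrow> (g has_derivative f') (at x)" for f'
    using assms by (metis has_derivative_transform_within_open)
  then show ?thesis by (simp add: frechet_derivative_def)
qed

lemma Ck_on_cong:
  assumes "open S" "\<And>x. x \<in> S \<Longrightarrow> f x = g x" "Ck_on k S f"
  shows "Ck_on k S g"
  using assms(2,3)
proof (induction k arbitrary: f g)
  case 0
  then show ?case by (metis Ck_on.simps(1) continuous_on_cong)
next
  case (Suc k)
  show ?case
  proof (simp, intro conjI ballI allI)
    fix x assume "x \<in> S"
    then show "g differentiable at x"
      using Suc.prems assms(1) by (metis Ck_on.simps(2) differentiable_def has_derivative_transform_within_open)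
  next
    fix v
    have "Ck_on k S (\<lambda>x. frechet_derivative f (at x) v)" using Suc.prems by simp
    then show "Ck_on k S (\<lambda>x. frechet_derivative g (at x) v)"
      by (rule Suc.IH[rotated]) (metis frechet_derivative_cong_open assms(1) Suc.prems(1))
  qed
qed

text \<open>\<open>Ck_on\<close> speaks of the choice operator \<open>frechet_derivative\<close>.
  This rule lets the inductions below work with an explicit derivative formula instead; openness of
  \<open>S\<close> is what makes the congruence legitimate.\<close>

lemma Ck_on_SucI:
  assumes "open S" "\<And>x. x \<in> S \<Longrightarrow> (f has_derivative f' x) (at x)" "\<And>v. Ck_on k S (\<lambda>x. f' x v)"
  shows "Ck_on (Suc k) S f"
proof (simp, intro conjI ballI allI)
  fix x assume "x \<in> S"
  then show "f differentiable at x" using assms(2) differentiable_def by blast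
next
  fix v
  show "Ck_on k S (\<lambda>x. frechet_derivative f (at x) v)"
    by (rule Ck_on_cong[OF assms(1) _ assms(3)[of v]]) (simp add: frechet_derivative_eq[OF assms(2)])
qed

lemma Ck_on_Suc_derivative:
  "Ck_on (Suc k) S f \<Longrightarrow> x \<in> S \<Longrightarrow> (f has_derivative frechet_derivative f (at x)) (at x)"
  by (simp add: has_frechet_derivative)

lemma Ck_on_SucD: "Ck_on (Suc k) S f \<Longrightarrow> Ck_on k S f"
proof (induction k arbitrary: f)
  case 0
  then show ?case by (auto intro: differentiable_imp_continuous_within continuous_at_imp_continuous_on)
next
  case (Suc k)
  then show ?case by (metis Ck_on.simps(2))
qed

lemma Ck_on_subset: "Ck_on k S f \<Longrightarrow> T \<subseteq> S \<Longrightarrow> Ck_on k T f"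
  by (induction k arbitrary: f) (auto intro: continuous_on_subset)

lemma Ck_on_locally:
  assumes "\<And>x. x \<in> S \<Longrightarrow> \<exists>T. open T \<and> x \<in> T \<and> Ck_on k T f"
  shows "Ck_on k S f"
  using assms
proof (induction k arbitrary: f)
  case 0
  then show ?case
    by (metis Ck_on.simps(1) continuous_at_imp_continuous_at_within continuous_on_eq_continuous_at
        continuous_on_eq_continuous_within)
next
  case (Suc k)
  then show ?case
    by (simp, metis)
qed

lemma Ck_on_const: "open S \<Longrightarrow> Ck_on k S (\<lambda>x. c)"
  by (induction k arbitrary: c) auto

lemma Ck_on_bounded_linear:
  assumes "open S" "bounded_linear h"
  shows "Ck_on k S h"
proof (cases k)
  case 0
  then show ?thesis by (simp add: linear_continuous_on assms)
next
  case (Suc j)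
  show ?thesis unfolding Suc
    by (rule Ck_on_SucI[OF assms(1) bounded_linear_imp_has_derivative[OF assms(2)]])
      (rule Ck_on_const[OF assms(1)])
qed

lemma Ck_on_add:
  assumes "open S" "Ck_on k S f" "Ck_on k S g"
  shows "Ck_on k S (\<lambda>x. f x + g x)"
  using assms(2,3)
proof (induction k arbitrary: f g)
  case 0
  then show ?case by (auto intro: continuous_on_add)
next
  case (Suc k)
  show ?case
  proof (rule Ck_on_SucI[OF assms(1)])
    show "((\<lambda>x. f x + g x) has_derivative
        (\<lambda>v. frechet_derivative f (at x) v + frechet_derivative g (at x) v)) (at x)" if "x \<in> S" for x
      by (intro has_derivative_add Ck_on_Suc_derivative[OF Suc.prems(1) that] Ck_on_Suc_derivative[OF Suc.prems(2) that])
  qed (use Suc in simp)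
qed

text \<open>Covers scalar multiplication and inner product at once. The product rule leaves one
  factor undifferentiated, so the induction step also needs \<open>f\<close> and \<open>g\<close> at
  the lower order, from \<open>Ck_on_SucD\<close>.\<close>

lemma Ck_on_bilinear:
  assumes "open S" "bounded_bilinear b" "Ck_on k S f" "Ck_on k S g"
  shows "Ck_on k S (\<lambda>x. b (f x) (g x))"
  using assms(3,4)
proof (induction k arbitrary: f g)
  case 0
  then show ?case by (auto intro: bounded_bilinear.continuous_on[OF assms(2)])
next
  case (Suc k)
  show ?case
  proof (rule Ck_on_SucI[OF assms(1)])
    show "((\<lambda>x. b (f x) (g x)) has_derivative
        (\<lambda>v. b (f x) (frechet_derivative g (at x) v) + b (frechet_derivative f (at x) v) (g x))) (at x)"
      if "x \<in> S" for x
      by (intro bounded_bilinear.FDERIV[OF assms(2)] Ck_on_Suc_derivative[OF Suc.prems(1) that]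
          Ck_on_Suc_derivative[OF Suc.prems(2) that])
  next
    fix v
    have "Ck_on k S f" "Ck_on k S g" using Suc.prems Ck_on_SucD by blast+
    then show "Ck_on k S (\<lambda>x. b (f x) (frechet_derivative g (at x) v) + b (frechet_derivative f (at x) v) (g x))"
      using Suc by (intro Ck_on_add[OF assms(1)] Suc.IH) auto
  qed
qed

lemma Ck_on_sum:
  assumes "open S" "\<And>i. i \<in> I \<Longrightarrow> Ck_on k S (f i)"
  shows "Ck_on k S (\<lambda>x. \<Sum>i\<in>I. f i x)"
  using assms(2)
  by (induction I rule: infinite_finite_induct) (auto intro: Ck_on_const Ck_on_add assms(1))

lemma linear_Basis_expansion:
  fixes h :: "'b::euclidean_space \<Rightarrow> 'c::real_vector"
  assumes "linear h"
  shows "h v = (\<Sum>b\<in>Basis. (v \<bullet> b) *\<^sub>R h b)"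
proof -
  have "h v = h (\<Sum>b\<in>Basis. (v \<bullet> b) *\<^sub>R b)" by (simp add: euclidean_representation)
  then show ?thesis by (simp add: linear_sum[OF assms] linear_scale[OF assms])
qed

lemma Ck_on_compose:
  fixes g :: "'a::real_normed_vector \<Rightarrow> 'b::euclidean_space" and f :: "'b \<Rightarrow> 'c::real_normed_vector"
  assumes "open S" "open T" "g ` S \<subseteq> T" "Ck_on k T f" "Ck_on k S g"
  shows "Ck_on k S (\<lambda>x. f (g x))"
  using assms(4,5)
proof (induction k arbitrary: f)
  case 0
  then show ?case using assms(3) by (auto intro: continuous_on_compose2)
next
  case (Suc k)
  have g: "Ck_on k S g" using Suc.prems(2) by (rule Ck_on_SucD)
  show ?case
  proof (rule Ck_on_SucI[OF assms(1)])
    show "((\<lambda>x. f (g x)) has_derivative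
        (\<lambda>v. frechet_derivative f (at (g x)) (frechet_derivative g (at x) v))) (at x)" if "x \<in> S" for x
    proof (rule has_derivative_compose[where g=f and f=g])
      show "(g has_derivative frechet_derivative g (at x)) (at x)"
        by (rule Ck_on_Suc_derivative[OF Suc.prems(2) that])
      show "(f has_derivative frechet_derivative f (at (g x))) (at (g x))"
        by (rule Ck_on_Suc_derivative[OF Suc.prems(1)]) (use that assms(3) in auto)
    qed
  next
    fix v
    \<comment> \<open>The induction controls derivatives of \<open>f\<close> in fixed directions
      only, whereas the chain rule applies them to a direction moving with \<open>x\<close>.
      Expanding the moving vector in the basis separates the two.\<close>
    have "Ck_on k S (\<lambda>x. \<Sum>b\<in>Basis. (frechet_derivative g (at x) v \<bullet> b) *\<^sub>R frechet_derivative f (at (g x)) b)"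
    proof (intro Ck_on_sum[OF assms(1)] Ck_on_bilinear[OF assms(1) bounded_bilinear_scaleR])
      fix b :: 'b
      show "Ck_on k S (\<lambda>x. frechet_derivative g (at x) v \<bullet> b)"
        by (rule Ck_on_bilinear[OF assms(1) bounded_bilinear_inner])
          (use Suc.prems Ck_on_const[OF assms(1)] in auto)
      show "Ck_on k S (\<lambda>x. frechet_derivative f (at (g x)) b)"
        using Suc.prems g by (intro Suc.IH) auto
    qed
    then show "Ck_on k S (\<lambda>x. frechet_derivative f (at (g x)) (frechet_derivative g (at x) v))"
    proof (rule Ck_on_cong[OF assms(1), rotated])
      fix x assume "x \<in> S"
      then have "f differentiable at (g x)" using Suc.prems assms(3) by auto
      then show "(\<Sum>b\<in>Basis. (frechet_derivative g (at x) v \<bullet> b) *\<^sub>R frechet_derivative f (at (g x)) b) =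
          frechet_derivative f (at (g x)) (frechet_derivative g (at x) v)"
        by (metis linear_Basis_expansion linear_frechet_derivative)
    qed
  qed
qed

section \<open>Closure rules for smooth maps\<close>

lemma smooth_on_cong:
  "open S \<Longrightarrow> (\<And>x. x \<in> S \<Longrightarrow> f x = g x) \<Longrightarrow> smooth_on S f \<Longrightarrow> smooth_on S g"
  unfolding smooth_on_def using Ck_on_cong by blast

lemma smooth_on_subset: "smooth_on S f \<Longrightarrow> T \<subseteq> S \<Longrightarrow> smooth_on T f"
  unfolding smooth_on_def using Ck_on_subset by blast

lemma smooth_on_locally:
  "(\<And>x. x \<in> S \<Longrightarrow> \<exists>T. open T \<and> x \<in> T \<and> smooth_on T f) \<Longrightarrow> smooth_on S f"
  unfolding smooth_on_def by (meson Ck_on_locally)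

lemma smooth_on_const: "open S \<Longrightarrow> smooth_on S (\<lambda>x. c)"
  by (simp add: smooth_on_def Ck_on_const)

lemma smooth_on_bounded_linear: "open S \<Longrightarrow> bounded_linear h \<Longrightarrow> smooth_on S h"
  by (simp add: smooth_on_def Ck_on_bounded_linear)

lemma smooth_on_add: "open S \<Longrightarrow> smooth_on S f \<Longrightarrow> smooth_on S g \<Longrightarrow> smooth_on S (\<lambda>x. f x + g x)"
  by (simp add: smooth_on_def Ck_on_add)

lemma smooth_on_bilinear:
  "open S \<Longrightarrow> bounded_bilinear b \<Longrightarrow> smooth_on S f \<Longrightarrow> smooth_on S g \<Longrightarrow> smooth_on S (\<lambda>x. b (f x) (g x))"
  by (simp add: smooth_on_def Ck_on_bilinear)

lemma smooth_on_sum: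
  "open S \<Longrightarrow> (\<And>i. i \<in> I \<Longrightarrow> smooth_on S (f i)) \<Longrightarrow> smooth_on S (\<lambda>x. \<Sum>i\<in>I. f i x)"
  by (simp add: smooth_on_def Ck_on_sum)

lemma smooth_on_compose:
  fixes g :: "'a::real_normed_vector \<Rightarrow> 'b::euclidean_space" and f :: "'b \<Rightarrow> 'c::real_normed_vector"
  shows "open S \<Longrightarrow> open T \<Longrightarrow> g ` S \<subseteq> T \<Longrightarrow> smooth_on T f \<Longrightarrow> smooth_on S g \<Longrightarrow> smooth_on S (\<lambda>x. f (g x))"
  unfolding smooth_on_def using Ck_on_compose by blast

lemma smooth_on_linear_compose:
  fixes g :: "'a::real_normed_vector \<Rightarrow> 'b::euclidean_space"
  shows "open S \<Longrightarrow> bounded_linear h \<Longrightarrow> smooth_on S g \<Longrightarrow> smooth_on S (\<lambda>x. h (g x))"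
  by (rule smooth_on_compose[where T=UNIV]) (auto intro: smooth_on_bounded_linear)

lemma smooth_on_diff:
  fixes f g :: "'a::real_normed_vector \<Rightarrow> 'b::euclidean_space"
  assumes "open S" "smooth_on S f" "smooth_on S g"
  shows "smooth_on S (\<lambda>x. f x - g x)"
  using smooth_on_add[OF assms(1,2) smooth_on_linear_compose[OF assms(1) bounded_linear_minus[OF bounded_linear_ident] assms(3)]]
  by simp

lemma smooth_on_Pair:
  fixes f :: "'a::real_normed_vector \<Rightarrow> 'b::euclidean_space" and g :: "'a \<Rightarrow> 'c::euclidean_space"
  assumes "open S" "smooth_on S f" "smooth_on S g"
  shows "smooth_on S (\<lambda>x. (f x, g x))"
proof -
  have "smooth_on S (\<lambda>x. (f x, 0) + (0, g x))"
    using assms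
    by (intro smooth_on_add smooth_on_linear_compose[where h="\<lambda>y. (y, 0)"] smooth_on_linear_compose[where h="\<lambda>y. (0, y)"])
      (auto intro: bounded_linear_Pair bounded_linear_ident bounded_linear_zero)
  then show ?thesis by simp
qed

lemma smooth_on_imp_continuous_on: "smooth_on S f \<Longrightarrow> continuous_on S f"
  unfolding smooth_on_def by (metis Ck_on.simps(1))

lemma smooth_on_has_derivative:
  "smooth_on S f \<Longrightarrow> x \<in> S \<Longrightarrow> (f has_derivative frechet_derivative f (at x)) (at x)"
  unfolding smooth_on_def using Ck_on_Suc_derivative by blast

lemma smooth_on_frechet_derivative:
  "smooth_on S f \<Longrightarrow> smooth_on S (\<lambda>x. frechet_derivative f (at x) v)"
  unfolding smooth_on_def by (metis Ck_on.simps(2))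

text \<open>The basis expansion of the chain rule again, now with base point and direction both
  varying. This is the form of the fibre part of the transition maps of \<open>TB\<close> and of a
  tangent map in coordinates.\<close>

lemma smooth_on_frechet_derivative_apply:
  fixes f :: "'a::euclidean_space \<Rightarrow> 'b::real_normed_vector" and h :: "'c::real_normed_vector \<Rightarrow> 'a"
  assumes "open S" "open T" "smooth_on T f" "smooth_on S h" "smooth_on S k" "k ` S \<subseteq> T"
  shows "smooth_on S (\<lambda>x. frechet_derivative f (at (k x)) (h x))"
proof -
  have "smooth_on S (\<lambda>x. \<Sum>b\<in>Basis. (h x \<bullet> b) *\<^sub>R frechet_derivative f (at (k x)) b)"
    by (intro smooth_on_sum smooth_on_bilinear[OF _ bounded_bilinear_scaleR] assms
        smooth_on_bilinear[OF _ bounded_bilinear_inner] smooth_on_const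
        smooth_on_compose[OF assms(1,2,6) smooth_on_frechet_derivative[OF assms(3)]])
  then show ?thesis
  proof (rule smooth_on_cong[OF assms(1), rotated])
    fix x assume "x \<in> S"
    then have "f differentiable (at (k x))"
      using smooth_on_has_derivative[OF assms(3)] assms(6) differentiable_def by blast
    then show "(\<Sum>b\<in>Basis. (h x \<bullet> b) *\<^sub>R frechet_derivative f (at (k x)) b) = frechet_derivative f (at (k x)) (h x)"
      by (metis linear_Basis_expansion linear_frechet_derivative)
  qed
qed

text \<open>Smoothness of the derivative gives one order more than is asked for, and that order is
  dropped. Needed for a primitive, of which only the derivative is known.\<close>

lemma smooth_onI_derivative:
  assumes "open S" "\<And>x. x \<in> S \<Longrightarrow> (f has_derivative f' x) (at x)" "\<And>v. smooth_on S (\<lambda>x. f' x v)"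
  shows "smooth_on S f"
  unfolding smooth_on_def
proof
  fix k
  have "Ck_on (Suc k) S f" using assms by (intro Ck_on_SucI) (auto simp: smooth_on_def)
  then show "Ck_on k S f" by (rule Ck_on_SucD)
qed

section \<open>Symmetry of second derivatives\<close>

lemma has_derivative_linear: "(f has_derivative f') F \<Longrightarrow> linear f'"
  using has_derivative_bounded_linear bounded_linear.linear by blast

text \<open>The mean value theorem applied twice, first along \<open>u\<close> to the increment in
  direction \<open>v\<close>, then along \<open>v\<close> to the derivative in direction
  \<open>u\<close>. The left side of the equation is symmetric in \<open>u\<close> and
  \<open>v\<close>; the right side is a mixed derivative at an intermediate point.\<close>

lemma second_difference:
  fixes f :: "'a::real_normed_vector \<Rightarrow> real"
  assumes t: "0 < t"
    and S: "\<And>a b. a \<in> {0..t} \<Longrightarrow> b \<in> {0..t} \<Longrightarrow> x + a *\<^sub>R u + b *\<^sub>R v \<in> S"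
    and f: "\<And>y. y \<in> S \<Longrightarrow> (f has_derivative f' y) (at y)"
    and g: "\<And>y. y \<in> S \<Longrightarrow> ((\<lambda>z. f' z u) has_derivative g' y) (at y)"
  obtains a b where "a \<in> {0..t}" "b \<in> {0..t}"
    "f (x + t *\<^sub>R u + t *\<^sub>R v) - f (x + t *\<^sub>R u) - f (x + t *\<^sub>R v) + f x = t * t * g' (x + a *\<^sub>R u + b *\<^sub>R v) v"
proof -
  let ?p = "\<lambda>a. f (x + a *\<^sub>R u + t *\<^sub>R v) - f (x + a *\<^sub>R u)"
  have line: "((\<lambda>a. f (x + a *\<^sub>R u + c *\<^sub>R v)) has_real_derivative f' (x + a *\<^sub>R u + c *\<^sub>R v) u) (at a)"
    if "a \<in> {0..t}" "c \<in> {0..t}" for a c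
  proof -
    have "((\<lambda>a. x + a *\<^sub>R u + c *\<^sub>R v) has_derivative (\<lambda>h. h *\<^sub>R u)) (at a)"
      by (auto intro!: derivative_eq_intros)
    from has_derivative_compose[OF this f[OF S[OF that]]]
    show ?thesis using has_derivative_linear[OF f[OF S[OF that]]]
      by (simp add: has_field_derivative_def linear_scale mult.commute[of _ "f' _ u"] cong: if_cong)
  qed
  have "\<exists>a>0. a < t \<and> ?p t - ?p 0 = (t - 0) * (f' (x + a *\<^sub>R u + t *\<^sub>R v) u - f' (x + a *\<^sub>R u) u)"
  proof (rule MVT2[OF t])
    fix a assume "0 \<le> a" "a \<le> t"
    with line[of a t] line[of a 0] t
    show "((\<lambda>a. ?p a) has_real_derivative f' (x + a *\<^sub>R u + t *\<^sub>R v) u - f' (x + a *\<^sub>R u) u) (at a)"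
      by (auto intro!: derivative_intros)
  qed
  then obtain a where a: "0 < a" "a < t"
    "?p t - ?p 0 = t * (f' (x + a *\<^sub>R u + t *\<^sub>R v) u - f' (x + a *\<^sub>R u) u)" by auto
  have "\<exists>b>0. b < t \<and> f' (x + a *\<^sub>R u + t *\<^sub>R v) u - f' (x + a *\<^sub>R u + 0 *\<^sub>R v) u =
      (t - 0) * g' (x + a *\<^sub>R u + b *\<^sub>R v) v"
  proof (rule MVT2[OF t, where f="\<lambda>b. f' (x + a *\<^sub>R u + b *\<^sub>R v) u"])
    fix b assume "0 \<le> b" "b \<le> t"
    then have in_S: "x + a *\<^sub>R u + b *\<^sub>R v \<in> S" using a S by auto
    have "((\<lambda>b. x + a *\<^sub>R u + b *\<^sub>R v) has_derivative (\<lambda>h. h *\<^sub>R v)) (at b)"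
      by (auto intro!: derivative_eq_intros)
    from has_derivative_compose[OF this g[OF in_S]]
    show "((\<lambda>b. f' (x + a *\<^sub>R u + b *\<^sub>R v) u) has_real_derivative g' (x + a *\<^sub>R u + b *\<^sub>R v) v) (at b)"
      using has_derivative_linear[OF g[OF in_S]]
      by (simp add: has_field_derivative_def linear_scale mult.commute[of _ "g' _ v"])
  qed
  then obtain b where b: "0 < b" "b < t"
    "f' (x + a *\<^sub>R u + t *\<^sub>R v) u - f' (x + a *\<^sub>R u) u = t * g' (x + a *\<^sub>R u + b *\<^sub>R v) v" by auto
  show thesis
    using a b by (intro that[of a b]) (auto simp: algebra_simps)
qed

lemma second_derivative_symmetric_real:
  fixes f :: "'a::euclidean_space \<Rightarrow> real"
  assumes "open S" "smooth_on S f" "x \<in> S"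
  shows "frechet_derivative (\<lambda>y. frechet_derivative f (at y) u) (at x) v =
         frechet_derivative (\<lambda>y. frechet_derivative f (at y) v) (at x) u"
proof -
  define D where "D = (\<lambda>u v y. frechet_derivative (\<lambda>z. frechet_derivative f (at z) u) (at y) v)"
  have sD: "smooth_on S (D u v)" for u v
    unfolding D_def by (intro smooth_on_frechet_derivative assms)
  have f: "(f has_derivative frechet_derivative f (at y)) (at y)" if "y \<in> S" for y
    using assms(2) that by (rule smooth_on_has_derivative)
  have g: "((\<lambda>z. frechet_derivative f (at z) u) has_derivative (\<lambda>v. D u v y)) (at y)" if "y \<in> S" for y u
    unfolding D_def using smooth_on_has_derivative[OF smooth_on_frechet_derivative[OF assms(2)] that] by simp
  have close: "\<bar>D u v x - D v u x\<bar> < e" if e: "e > 0" for e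
  proof -
    have "continuous (at x) (D u v)" "continuous (at x) (D v u)"
      using sD smooth_on_imp_continuous_on assms by (metis continuous_on_eq_continuous_at)+
    then obtain d1 d2 where d: "d1 > 0" "d2 > 0"
      "\<And>y. dist y x < d1 \<Longrightarrow> dist (D u v y) (D u v x) < e/2"
      "\<And>y. dist y x < d2 \<Longrightarrow> dist (D v u y) (D v u x) < e/2"
      using e unfolding continuous_at_eps_delta by (metis half_gt_zero)
    obtain d3 where d3: "d3 > 0" "ball x d3 \<subseteq> S" using assms openE by blast
    define d where "d = min d1 (min d2 d3)"
    have dpos: "d > 0" using d d3 by (simp add: d_def)
    \<comment> \<open>With this choice \<open>t * (norm u + norm v + 1) = d / 2\<close>, so the
      whole parallelogram with sides \<open>t *\<^sub>R u\<close> and \<open>t *\<^sub>R v\<close>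
      stays within distance \<open>d\<close> of \<open>x\<close>; the summand 1 keeps the
      denominator positive when \<open>u\<close> and \<open>v\<close> vanish.\<close>
    define t where "t = d / (2 * (norm u + norm v + 1))"
    have np: "norm u + norm v + 1 > 0" by (simp add: add_nonneg_pos)
    have t: "t > 0" using dpos np by (simp add: t_def)
    have near: "dist (x + a *\<^sub>R u + b *\<^sub>R v) x < d" if "a \<in> {0..t}" "b \<in> {0..t}" for a b
    proof -
      have "dist (x + a *\<^sub>R u + b *\<^sub>R v) x = norm (a *\<^sub>R u + b *\<^sub>R v)"
        by (simp add: dist_norm add.assoc)
      also have "\<dots> \<le> a * norm u + b * norm v" using that by (intro norm_triangle_le) auto
      also have "\<dots> \<le> t * norm u + t * norm v"
        using that by (intro add_mono mult_right_mono) auto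
      also have "\<dots> \<le> t * (norm u + norm v + 1)" using t by (simp add: algebra_simps)
      also have "\<dots> = d / 2" using np unfolding t_def by (subst (asm) less_le) (simp add: divide_simps)
      also have "\<dots> < d" using dpos by simp
      finally show ?thesis .
    qed
    have near_S: "x + a *\<^sub>R u + b *\<^sub>R v \<in> S" if "a \<in> {0..t}" "b \<in> {0..t}" for a b
      using near[OF that] d3 by (auto simp: d_def dist_commute)
    obtain a b where ab: "a \<in> {0..t}" "b \<in> {0..t}"
      "f (x + t *\<^sub>R u + t *\<^sub>R v) - f (x + t *\<^sub>R u) - f (x + t *\<^sub>R v) + f x = t * t * D u v (x + a *\<^sub>R u + b *\<^sub>R v)"
      using second_difference[OF t near_S f g] by blast
    have near_S': "x + a *\<^sub>R v + b *\<^sub>R u \<in> S" if "a \<in> {0..t}" "b \<in> {0..t}" for a b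
      using near_S[OF that(2,1)] by (simp add: add.commute add.left_commute)
    obtain a' b' where ab': "a' \<in> {0..t}" "b' \<in> {0..t}"
      "f (x + t *\<^sub>R v + t *\<^sub>R u) - f (x + t *\<^sub>R v) - f (x + t *\<^sub>R u) + f x = t * t * D v u (x + a' *\<^sub>R v + b' *\<^sub>R u)"
      using second_difference[OF t near_S' f g] by blast
    \<comment> \<open>Both sides equal the same second difference, taken in the two orders.\<close>
    have "t * t * D u v (x + a *\<^sub>R u + b *\<^sub>R v) = t * t * D v u (x + b' *\<^sub>R u + a' *\<^sub>R v)"
    proof -
      have "x + c *\<^sub>R v + c' *\<^sub>R u = x + c' *\<^sub>R u + c *\<^sub>R v" for c c' by simp
      from ab(3) ab'(3)[unfolded this] show ?thesis by linarith
    qed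
    then have "D u v (x + a *\<^sub>R u + b *\<^sub>R v) = D v u (x + b' *\<^sub>R u + a' *\<^sub>R v)" using t by simp
    moreover have "dist (D u v (x + a *\<^sub>R u + b *\<^sub>R v)) (D u v x) < e/2"
      using near[OF ab(1,2)] by (intro d) (simp add: d_def)
    moreover have "dist (D v u (x + b' *\<^sub>R u + a' *\<^sub>R v)) (D v u x) < e/2"
      using near[OF ab'(2,1)] by (intro d) (simp add: d_def)
    ultimately show ?thesis unfolding dist_real_def by linarith
  qed
  have "D u v x = D v u x"
  proof (rule ccontr)
    assume "D u v x \<noteq> D v u x"
    then show False using close[of "\<bar>D u v x - D v u x\<bar>"] by simp
  qed
  then show ?thesis by (simp add: D_def)
qed

lemma second_derivative_symmetric:
  fixes f :: "'a::euclidean_space \<Rightarrow> 'b::euclidean_space"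
  assumes "open S" "smooth_on S f" "x \<in> S"
  shows "frechet_derivative (\<lambda>y. frechet_derivative f (at y) u) (at x) v =
         frechet_derivative (\<lambda>y. frechet_derivative f (at y) v) (at x) u"
proof (rule euclidean_eqI)
  fix b :: 'b
  define fb where "fb = (\<lambda>y. f y \<bullet> b)"
  have sfb: "smooth_on S fb"
    unfolding fb_def by (intro smooth_on_bilinear[OF _ bounded_bilinear_inner] assms smooth_on_const)
  have 1: "frechet_derivative fb (at y) u = frechet_derivative f (at y) u \<bullet> b" if "y \<in> S" for y u
    by (subst frechet_derivative_eq[where f=fb and f'="\<lambda>u. frechet_derivative f (at y) u \<bullet> b"])
      (auto simp: fb_def intro!: has_derivative_inner_left smooth_on_has_derivative[OF assms(2) that])
  have 2: "frechet_derivative (\<lambda>y. frechet_derivative fb (at y) u) (at x) v =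
      frechet_derivative (\<lambda>y. frechet_derivative f (at y) u) (at x) v \<bullet> b" for u v
  proof -
    have "frechet_derivative (\<lambda>y. frechet_derivative fb (at y) u) (at x) =
        frechet_derivative (\<lambda>y. frechet_derivative f (at y) u \<bullet> b) (at x)"
      by (rule frechet_derivative_cong_open[OF assms(1,3) 1])
    also have "\<dots> = (\<lambda>v. frechet_derivative (\<lambda>y. frechet_derivative f (at y) u) (at x) v \<bullet> b)"
      by (intro frechet_derivative_eq has_derivative_inner_left
          smooth_on_has_derivative[OF smooth_on_frechet_derivative[OF assms(2)] assms(3)])
    finally show ?thesis by simp
  qed
  show "frechet_derivative (\<lambda>y. frechet_derivative f (at y) u) (at x) v \<bullet> b =
      frechet_derivative (\<lambda>y. frechet_derivative f (at y) v) (at x) u \<bullet> b"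
    using second_derivative_symmetric_real[OF assms(1) sfb assms(3), of u v] by (simp add: 2)
qed

section \<open>Closed one-forms on balls\<close>

text \<open>The radial primitive: integrate the form along the segment from the centre to
  \<open>z\<close>. Closedness turns the \<open>z\<close>-derivative of the integrand into pairing
  with \<open>c z s\<close>, which is also the \<open>s\<close>-derivative of
  \<open>s *\<^sub>R a (y0 + s *\<^sub>R (z - y0))\<close>; integrating from 0 to 1 therefore leaves
  \<open>a z\<close>.\<close>

lemma poincare_ball:
  fixes a :: "'a::euclidean_space \<Rightarrow> 'a"
  assumes a: "smooth_on (ball y0 r) a"
    and closed: "\<And>z u w. z \<in> ball y0 r \<Longrightarrow>
        frechet_derivative a (at z) u \<bullet> w = frechet_derivative a (at z) w \<bullet> u"
  shows "\<exists>f. \<forall>z\<in>ball y0 r. (f has_derivative (\<lambda>w. a z \<bullet> w)) (at z)"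
proof -
  let ?O = "ball y0 r"
  let ?D = "\<lambda>y. frechet_derivative a (at y)"
  let ?p = "\<lambda>z s. y0 + s *\<^sub>R (z - y0)"
  define c where "c = (\<lambda>z s. s *\<^sub>R ?D (?p z s) (z - y0) + a (?p z s))"
  define f where "f = (\<lambda>z. integral (cbox 0 1) (\<lambda>s::real. a (?p z s) \<bullet> (z - y0)))"
  have p_in: "?p z s \<in> ?O" if "z \<in> ?O" "s \<in> cbox 0 1" for z and s :: real
  proof -
    have "?p z s = (1 - s) *\<^sub>R y0 + s *\<^sub>R z" by (simp add: algebra_simps)
    moreover have "y0 \<in> ?O" using that(1) by (metis centre_in_ball ball_eq_empty empty_iff not_le)
    ultimately show ?thesis
      using convexD_alt[OF convex_ball, of y0 y0 r z s] that by simp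
  qed
  have a_deriv: "(a has_derivative ?D y) (at y)" if "y \<in> ?O" for y
    using smooth_on_has_derivative[OF a that] .
  have cont_a: "continuous_on ?O a" using a by (rule smooth_on_imp_continuous_on)
  have cont_p: "continuous_on (?O \<times> cbox 0 1) (\<lambda>x. ?p (fst x) (snd x))"
    by (intro continuous_intros)
  have cont_D: "continuous_on (?O \<times> cbox 0 1) (\<lambda>x. ?D (?p (fst x) (snd x)) (fst x - y0))"
  proof -
    have "continuous_on (?O \<times> cbox 0 1)
        (\<lambda>x. \<Sum>b\<in>Basis. ((fst x - y0) \<bullet> b) *\<^sub>R ?D (?p (fst x) (snd x)) b)"
    proof (intro continuous_intros)
      fix b :: 'a
      show "continuous_on (?O \<times> cbox 0 1) (\<lambda>x. ?D (?p (fst x) (snd x)) b)"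
        by (rule continuous_on_compose2[OF smooth_on_imp_continuous_on[OF smooth_on_frechet_derivative[OF a, of b]] cont_p])
          (use p_in in auto)
    qed
    then show ?thesis
    proof (rule continuous_on_eq)
      fix x :: "'a \<times> real" assume "x \<in> ?O \<times> cbox 0 1"
      then have "linear (?D (?p (fst x) (snd x)))" by (auto intro!: has_derivative_linear[OF a_deriv] p_in)
      then show "(\<Sum>b\<in>Basis. ((fst x - y0) \<bullet> b) *\<^sub>R ?D (?p (fst x) (snd x)) b) = ?D (?p (fst x) (snd x)) (fst x - y0)"
        by (rule linear_Basis_expansion[symmetric])
    qed
  qed
  have cont_c: "continuous_on (?O \<times> cbox 0 1) (\<lambda>(z, s). c z s)"
    unfolding c_def split_beta
    by (intro continuous_intros cont_D continuous_on_compose2[OF cont_a cont_p]) (use p_in in auto)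
  have "(f has_derivative (\<lambda>w. a z0 \<bullet> w)) (at z0)" if z0: "z0 \<in> ?O" for z0
  proof -
    have deriv_c: "((\<lambda>s. s *\<^sub>R a (?p z0 s)) has_vector_derivative c z0 s) (at s within cbox 0 1)"
      if s: "s \<in> cbox 0 1" for s
    proof -
      have "((\<lambda>s. ?p z0 s) has_derivative (\<lambda>h. h *\<^sub>R (z0 - y0))) (at s)"
        by (auto intro!: derivative_eq_intros)
      from has_derivative_compose[OF this a_deriv[OF p_in[OF z0 s]]]
      have "((\<lambda>s. a (?p z0 s)) has_vector_derivative ?D (?p z0 s) (z0 - y0)) (at s)"
        unfolding has_vector_derivative_def
        by (simp add: linear_scale[OF has_derivative_linear[OF a_deriv[OF p_in[OF z0 s]]]])
      from has_vector_derivative_scaleR[OF DERIV_ident this]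
      show ?thesis unfolding c_def by (auto intro: has_vector_derivative_at_within)
    qed
    have int_c: "((\<lambda>s. c z0 s) has_integral a z0) (cbox 0 1)"
      using fundamental_theorem_of_calculus[of 0 1 "\<lambda>s. s *\<^sub>R a (?p z0 s)" "c z0"] deriv_c
      by (simp add: algebra_simps)
    \<comment> \<open>\<open>leibniz_rule\<close> expects the parameter derivative as a bounded
      linear function, hence the passage from the vector \<open>c z s\<close> to
      \<open>blinfun_inner_right (c z s)\<close>.\<close>
    have "(f has_derivative integral (cbox 0 1) (\<lambda>s. blinfun_inner_right (c z0 s))) (at z0 within ?O)"
      unfolding f_def
    proof (rule leibniz_rule[where fx="\<lambda>z s. blinfun_inner_right (c z s)" and U="?O"])
      fix z s assume zs: "z \<in> ?O" "s \<in> cbox (0::real) 1"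
      have "((\<lambda>z. ?p z s) has_derivative (\<lambda>w. s *\<^sub>R w)) (at z)"
        by (auto intro!: derivative_eq_intros)
      from has_derivative_compose[OF this a_deriv[OF p_in[OF zs]]]
      have "((\<lambda>z. a (?p z s) \<bullet> (z - y0)) has_derivative
          (\<lambda>w. a (?p z s) \<bullet> w + ?D (?p z s) (s *\<^sub>R w) \<bullet> (z - y0))) (at z)"
        by (auto intro!: derivative_eq_intros)
      moreover have "a (?p z s) \<bullet> w + ?D (?p z s) (s *\<^sub>R w) \<bullet> (z - y0) = c z s \<bullet> w" for w
        unfolding c_def linear_scale[OF has_derivative_linear[OF a_deriv[OF p_in[OF zs]]]]
        using closed[OF p_in[OF zs], of w "z - y0"] by (simp add: inner_add_left)
      ultimately show "((\<lambda>z. a (?p z s) \<bullet> (z - y0)) has_derivative blinfun_apply (blinfun_inner_right (c z s))) (at z within ?O)"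
        by (simp add: has_derivative_at_withinI)
    next
      fix z assume z: "z \<in> ?O"
      show "(\<lambda>s. a (?p z s) \<bullet> (z - y0)) integrable_on cbox 0 1"
        by (intro integrable_continuous continuous_intros continuous_on_compose2[OF cont_a])
          (use p_in[OF z] in auto)
    next
      show "continuous_on (?O \<times> cbox 0 1) (\<lambda>(z, s). blinfun_inner_right (c z s))"
        using bounded_linear.continuous_on[OF bounded_linear_blinfun_inner_right cont_c]
        by (simp add: split_beta)
    qed (use z0 in auto)
    moreover have "integral (cbox 0 1) (\<lambda>s. blinfun_inner_right (c z0 s)) = blinfun_inner_right (a z0)"
      using has_integral_linear[OF int_c bounded_linear_blinfun_inner_right]
      by (intro integral_unique) (simp add: o_def)
    ultimately show ?thesis
      using z0 by (simp add: at_within_open[OF z0 open_ball])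
  qed
  then show ?thesis by blast
qed

section \<open>Atlases and their tangent bundles\<close>

text \<open>Isolates the conditions on charts, so that they can be carried from \<open>Q\<close> to
  \<open>TB Q\<close> by \<open>smooth_atlas_TB\<close> and the chart lemmas become available
  there.\<close>

definition smooth_atlas :: "('a, 'i, 'e::euclidean_space) atlas \<Rightarrow> bool" where
  "smooth_atlas A \<longleftrightarrow>
     (\<forall>i. inj_on (chart A i) (cdom A i)) \<and>
     (\<forall>i j. open (chart A i ` (cdom A i \<inter> cdom A j))) \<and>
     (\<forall>i j. smooth_on (chart A i ` (cdom A i \<inter> cdom A j)) (transition A i j))"

lemma smooth_manifold_imp_smooth_atlas: "smooth_manifold A \<Longrightarrow> smooth_atlas A"
  by (simp add: smooth_manifold_def smooth_atlas_def)

lemma smooth_atlasD: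
  assumes "smooth_atlas A"
  shows "inj_on (chart A i) (cdom A i)" "open (chart A i ` (cdom A i \<inter> cdom A j))"
    "smooth_on (chart A i ` (cdom A i \<inter> cdom A j)) (transition A i j)"
  using assms by (auto simp: smooth_atlas_def)

lemma chart_inv_chart: "smooth_atlas A \<Longrightarrow> x \<in> cdom A i \<Longrightarrow> chart_inv A i (chart A i x) = x"
  by (simp add: chart_inv_def smooth_atlasD(1))

lemma chart_inv_in: "y \<in> chart A i ` cdom A i \<Longrightarrow> chart_inv A i y \<in> cdom A i"
  by (simp add: chart_inv_def inv_into_into)

lemma transition_chart: "smooth_atlas A \<Longrightarrow> x \<in> cdom A i \<Longrightarrow> transition A i j (chart A i x) = chart A j x"
  by (simp add: transition_def chart_inv_chart)

lemma chart_inv_in_iff: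
  assumes "smooth_atlas A" "y \<in> chart A i ` cdom A i"
  shows "chart_inv A i y \<in> cdom A j \<longleftrightarrow> y \<in> chart A i ` (cdom A i \<inter> cdom A j)"
  using assms by (auto simp: chart_inv_chart)

lemma transition_has_derivative:
  assumes "smooth_atlas A" "x \<in> cdom A i" "x \<in> cdom A j"
  shows "(transition A i j has_derivative frechet_derivative (transition A i j) (at (chart A i x))) (at (chart A i x))"
  using smooth_on_has_derivative[OF smooth_atlasD(3)[OF assms(1), of i j]] assms by blast

text \<open>The chain rule for \<open>transition A i k\<close>, which coincides with the composite
  through chart \<open>j\<close> only on the overlap of \<open>i\<close> and \<open>j\<close>; the
  overlap has open image, and that suffices for the derivative.\<close>

lemma transition_derivative_cocycle:
  assumes A: "smooth_atlas A" and x: "x \<in> cdom A i" "x \<in> cdom A j" "x \<in> cdom A k"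
  shows "frechet_derivative (transition A i k) (at (chart A i x)) v =
    frechet_derivative (transition A j k) (at (chart A j x)) (frechet_derivative (transition A i j) (at (chart A i x)) v)"
proof -
  let ?S = "chart A i ` (cdom A i \<inter> cdom A j)"
  have "((\<lambda>y. transition A j k (transition A i j y)) has_derivative
      (\<lambda>v. frechet_derivative (transition A j k) (at (chart A j x)) (frechet_derivative (transition A i j) (at (chart A i x)) v)))
      (at (chart A i x))"
    using has_derivative_compose[OF transition_has_derivative[OF A x(1,2)], of "transition A j k"]
      transition_has_derivative[OF A x(2,3)] transition_chart[OF A x(1)] by simp
  then have "(transition A i k has_derivative
      (\<lambda>v. frechet_derivative (transition A j k) (at (chart A j x)) (frechet_derivative (transition A i j) (at (chart A i x)) v)))
      (at (chart A i x))"
    by (rule has_derivative_transform_within_open[OF _ smooth_atlasD(2)[OF A, of i j]])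
      (use x in \<open>auto simp: transition_chart[OF A]\<close>)
  then show ?thesis by (simp add: frechet_derivative_eq)
qed

lemma transition_derivative_refl:
  assumes A: "smooth_atlas A" and x: "x \<in> cdom A i"
  shows "frechet_derivative (transition A i i) (at (chart A i x)) v = v"
proof -
  have "(transition A i i has_derivative (\<lambda>v. v)) (at (chart A i x))"
    by (rule has_derivative_transform_within_open[OF has_derivative_ident smooth_atlasD(2)[OF A, of i i]])
      (use x in \<open>auto simp: transition_chart[OF A]\<close>)
  then show ?thesis by (simp add: frechet_derivative_eq)
qed

lemma cdom_TB [simp]: "(p, v) \<in> cdom (TB A) i \<longleftrightarrow> p \<in> cdom A i \<and> v \<in> tangent_vectors A p"
  and chart_TB [simp]: "chart (TB A) i (p, v) = (chart A i p, v i)"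
  and cdom_CB [simp]: "(p, v) \<in> cdom (CB A) i \<longleftrightarrow> p \<in> cdom A i \<and> v \<in> cotangent_vectors A p"
  and chart_CB [simp]: "chart (CB A) i (p, v) = (chart A i p, v i)"
  by (auto simp: TB_def CB_def)

lemma carrier_iff: "x \<in> carrier A \<longleftrightarrow> (\<exists>i. x \<in> cdom A i)"
  by (auto simp: carrier_def)

text \<open>The condition \<open>v \<in> tangent_vectors A p\<close> does not mention the chart, so
  a point known to be in the carrier lies in chart \<open>i\<close> as soon as its base point
  does.\<close>

lemma carrier_TB_cdom_iff: "x \<in> carrier (TB A) \<Longrightarrow> x \<in> cdom (TB A) i \<longleftrightarrow> fst x \<in> cdom A i"
  by (cases x) (auto simp: carrier_iff)

lemma carrier_CB_cdom_iff: "x \<in> carrier (CB A) \<Longrightarrow> x \<in> cdom (CB A) i \<longleftrightarrow> fst x \<in> cdom A i"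
  by (cases x) (auto simp: carrier_iff)

lemma chart_TB_eq: "chart (TB A) i x = (chart A i (fst x), snd x i)"
  and chart_CB_eq: "chart (CB A) i x = (chart A i (fst x), snd x i)"
  by (cases x; simp)+

lemma tangent_vectors_transition:
  assumes "v \<in> tangent_vectors A p" "p \<in> cdom A i" "p \<in> cdom A j"
  shows "v j = frechet_derivative (transition A i j) (at (chart A i p)) (v i)"
  using assms unfolding tangent_vectors_def by blast

lemma tangent_vectors_eqI:
  assumes "v \<in> tangent_vectors A p" "w \<in> tangent_vectors A p" "p \<in> cdom A i" "v i = w i"
  shows "v = w"
proof
  fix j
  show "v j = w j"
  proof (cases "p \<in> cdom A j")
    case True
    then show ?thesis using assms tangent_vectors_transition by metis
  next
    case False
    then have "v j = 0" "w j = 0" using assms(1,2) unfolding tangent_vectors_def by blast+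
    then show ?thesis by simp
  qed
qed

text \<open>A component prescribed in one chart determines all others through the Jacobians of the
  transitions, and the cocycle rule makes the family consistent. Hence the fibre coordinate is onto
  and chart images of \<open>TB\<close> are full products.\<close>

lemma tangent_vector_exists:
  fixes A :: "('a, 'i, 'e::euclidean_space) atlas"
  assumes A: "smooth_atlas A" and p: "p \<in> cdom A i"
  obtains v where "v \<in> tangent_vectors A p" "v i = (e :: 'e)"
proof
  let ?v = "\<lambda>j. if p \<in> cdom A j then frechet_derivative (transition A i j) (at (chart A i p)) e else 0"
  show "?v \<in> tangent_vectors A p"
    unfolding tangent_vectors_def
  proof (intro CollectI conjI allI impI)
    fix j k assume jk: "p \<in> cdom A j" "p \<in> cdom A k"
    show "?v k = frechet_derivative (transition A j k) (at (chart A j p)) (?v j)"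
      unfolding if_P[OF jk(1)] if_P[OF jk(2)] by (rule transition_derivative_cocycle[OF A p jk])
  qed simp
  show "?v i = e" using p transition_derivative_refl[OF A p] by simp
qed

lemma chart_TB_image:
  fixes A :: "('a, 'i, 'e::euclidean_space) atlas"
  assumes A: "smooth_atlas A"
  shows "chart (TB A) i ` (cdom (TB A) i \<inter> cdom (TB A) j) = chart A i ` (cdom A i \<inter> cdom A j) \<times> (UNIV :: 'e set)"
proof (intro equalityI subsetI)
  fix y assume "y \<in> chart A i ` (cdom A i \<inter> cdom A j) \<times> (UNIV :: 'e set)"
  then obtain p e where p: "p \<in> cdom A i" "p \<in> cdom A j" "y = (chart A i p, e)" by auto
  obtain v where "v \<in> tangent_vectors A p" "v i = e" using tangent_vector_exists[OF A p(1)] .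
  with p have "(p, v) \<in> cdom (TB A) i \<inter> cdom (TB A) j" "y = chart (TB A) i (p, v)" by auto
  then show "y \<in> chart (TB A) i ` (cdom (TB A) i \<inter> cdom (TB A) j)" by blast
qed auto

lemma smooth_atlas_TB:
  fixes A :: "('a, 'i, 'e::euclidean_space) atlas"
  assumes A: "smooth_atlas A"
  shows "smooth_atlas (TB A)"
proof -
  have inj: "inj_on (chart (TB A) i) (cdom (TB A) i)" for i
  proof (rule inj_onI; clarify)
    fix p v q w assume *: "(p, v) \<in> cdom (TB A) i" "(q, w) \<in> cdom (TB A) i" "chart (TB A) i (p, v) = chart (TB A) i (q, w)"
    then have "p = q" using smooth_atlasD(1)[OF A, of i] by (auto simp: inj_on_def)
    with * show "p = q \<and> v = w" by (auto intro: tangent_vectors_eqI)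
  qed
  have op: "open (chart (TB A) i ` (cdom (TB A) i \<inter> cdom (TB A) j))" for i j
    unfolding chart_TB_image[OF A] by (intro open_Times smooth_atlasD(2)[OF A] open_UNIV)
  have "smooth_on (chart (TB A) i ` (cdom (TB A) i \<inter> cdom (TB A) j)) (transition (TB A) i j)" for i j
  proof (rule smooth_on_cong[OF op])
    let ?S = "chart A i ` (cdom A i \<inter> cdom A j)"
    have o: "open (?S \<times> (UNIV :: 'e set))" by (intro open_Times smooth_atlasD(2)[OF A] open_UNIV)
    \<comment> \<open>The transition map of the tangent bundle: the transition of the base together
      with its derivative acting on the fibre coordinate.\<close>
    show "smooth_on (chart (TB A) i ` (cdom (TB A) i \<inter> cdom (TB A) j))
       (\<lambda>y. (transition A i j (fst y), frechet_derivative (transition A i j) (at (fst y)) (snd y)))"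
      unfolding chart_TB_image[OF A]
      by (intro smooth_on_Pair o
          smooth_on_compose[OF o smooth_atlasD(2)[OF A] _ smooth_atlasD(3)[OF A]]
          smooth_on_frechet_derivative_apply[OF o smooth_atlasD(2)[OF A] smooth_atlasD(3)[OF A]]
          smooth_on_bounded_linear bounded_linear_fst bounded_linear_snd) auto
    fix y assume "y \<in> chart (TB A) i ` (cdom (TB A) i \<inter> cdom (TB A) j)"
    then obtain p v where p: "(p, v) \<in> cdom (TB A) i" "(p, v) \<in> cdom (TB A) j" "y = chart (TB A) i (p, v)" by auto
    have "chart_inv (TB A) i y = (p, v)"
      using inv_into_f_f[OF inj p(1)] p(3) by (simp add: chart_inv_def)
    then have "transition (TB A) i j y = (chart A j p, v j)" by (simp add: transition_def)
    then show "(transition A i j (fst y), frechet_derivative (transition A i j) (at (fst y)) (snd y)) = transition (TB A) i j y"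
      using p tangent_vectors_transition[of v A _ i j] by (auto simp: transition_chart[OF A])
  qed
  with inj op show ?thesis by (simp add: smooth_atlas_def)
qed

section \<open>Open sets and functions described in a single chart\<close>

lemma openin_chart_image:
  assumes "smooth_atlas A" "openin (mtopology A) W"
  shows "open (chart A i ` (W \<inter> cdom A i))" "W \<subseteq> carrier A"
  using assms openin_mtopology[OF smooth_atlasD(1)[OF assms(1)]] by auto

lemma chart_preimage:
  assumes A: "smooth_atlas A" and O: "T \<subseteq> chart A i ` cdom A i"
  shows "chart A j ` ({x \<in> cdom A i. chart A i x \<in> T} \<inter> cdom A j) =
    chart A j ` (cdom A j \<inter> cdom A i) \<inter> transition A j i -` T"
  using transition_chart[OF A] by (auto simp: image_iff)

lemma openin_chart_preimage:
  assumes A: "smooth_atlas A" and O: "open T" "T \<subseteq> chart A i ` cdom A i"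
  shows "openin (mtopology A) {x \<in> cdom A i. chart A i x \<in> T}"
  unfolding openin_mtopology[OF smooth_atlasD(1)[OF A]]
proof (intro conjI allI)
  show "{x \<in> cdom A i. chart A i x \<in> T} \<subseteq> carrier A" by (auto simp: carrier_iff)
next
  fix j
  have "open (chart A j ` (cdom A j \<inter> cdom A i) \<inter> transition A j i -` T)"
    using smooth_atlasD(2)[OF A] smooth_on_imp_continuous_on[OF smooth_atlasD(3)[OF A]] O(1)
    by (intro continuous_open_preimage) auto
  then show "open (chart A j ` ({x \<in> cdom A i. chart A i x \<in> T} \<inter> cdom A j))"
    unfolding chart_preimage[OF A O(2)] .
qed

text \<open>The Lagrangian is built in the coordinates of one chart; composing with a transition
  shows that it is smooth in all the others.\<close>

lemma smooth_function_chart: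
  fixes A :: "('a, 'i, 'e::euclidean_space) atlas"
  assumes A: "smooth_atlas A" and O: "open T" "T \<subseteq> chart A i ` cdom A i" and h: "smooth_on T h"
  shows "smooth_function_on A {x \<in> cdom A i. chart A i x \<in> T} (h \<circ> chart A i)"
  unfolding smooth_function_on_def
proof
  fix j
  let ?S = "chart A j ` ({x \<in> cdom A i. chart A i x \<in> T} \<inter> cdom A j)"
  have S: "open ?S"
    using openin_chart_image(1)[OF A openin_chart_preimage[OF A O]] .
  have S_sub: "?S \<subseteq> chart A j ` (cdom A j \<inter> cdom A i)" by auto
  have "smooth_on ?S (\<lambda>y. h (transition A j i y))"
    by (rule smooth_on_compose[OF S O(1) _ h smooth_on_subset[OF smooth_atlasD(3)[OF A] S_sub]])
      (auto simp: transition_chart[OF A])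
  then show "smooth_on ?S ((h \<circ> chart A i) \<circ> chart_inv A j)"
    by (simp add: transition_def o_def)
qed

section \<open>Curves and smooth maps\<close>

lemma smooth_curve_chart_inv:
  fixes A :: "('a, 'i, 'e::euclidean_space) atlas"
  assumes A: "smooth_atlas A" and J: "open J" and g: "smooth_on J g" "g ` J \<subseteq> chart A i ` cdom A i"
  shows "smooth_curve A J (\<lambda>t. chart_inv A i (g t))"
  unfolding smooth_curve_def
proof (intro conjI allI)
  show "(\<lambda>t. chart_inv A i (g t)) ` J \<subseteq> carrier A"
    using chart_inv_in[OF subsetD[OF g(2) imageI]] unfolding carrier_def by blast
next
  fix j
  let ?S = "chart A i ` (cdom A i \<inter> cdom A j)"
  let ?J = "{t\<in>J. chart_inv A i (g t) \<in> cdom A j}"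
  have eq: "?J = J \<inter> g -` ?S"
    using chart_inv_in_iff[OF A subsetD[OF g(2) imageI], of _ j] by blast
  show op: "open ?J"
    unfolding eq using J smooth_on_imp_continuous_on[OF g(1)] smooth_atlasD(2)[OF A]
    by (intro continuous_open_preimage) auto
  have "smooth_on ?J (\<lambda>t. transition A i j (g t))"
    by (rule smooth_on_compose[OF op smooth_atlasD(2)[OF A] _ smooth_atlasD(3)[OF A] smooth_on_subset[OF g(1)]])
      (auto simp: eq)
  then show "smooth_on ?J (chart A j \<circ> (\<lambda>t. chart_inv A i (g t)))"
    by (simp add: transition_def o_def)
qed

lemma smooth_curve_subset:
  assumes c: "smooth_curve A J c" and J: "open J'" "J' \<subseteq> J"
  shows "smooth_curve A J' c"
  unfolding smooth_curve_def
proof (intro conjI allI)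
  show "c ` J' \<subseteq> carrier A" using c J by (auto simp: smooth_curve_def)
  fix i
  have "{t\<in>J'. c t \<in> cdom A i} = {t\<in>J. c t \<in> cdom A i} \<inter> J'" using J by auto
  then show "open {t\<in>J'. c t \<in> cdom A i}" using c J by (simp add: smooth_curve_def open_Int)
  show "smooth_on {t\<in>J'. c t \<in> cdom A i} (chart A i \<circ> c)"
    by (rule smooth_on_subset[of "{t\<in>J. c t \<in> cdom A i}"]) (use c J in \<open>auto simp: smooth_curve_def\<close>)
qed

lemma smooth_curveD:
  assumes "smooth_curve A J c"
  shows "t \<in> J \<Longrightarrow> c t \<in> carrier A" "open {t\<in>J. c t \<in> cdom A i}" "smooth_on {t\<in>J. c t \<in> cdom A i} (chart A i \<circ> c)"
  using assms by (auto simp: smooth_curve_def)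

lemma smooth_curve_open_preimage:
  assumes A: "smooth_atlas A" and c: "smooth_curve A J c" and W: "openin (mtopology A) W"
  shows "open {t\<in>J. c t \<in> W}"
proof -
  have "{t\<in>J. c t \<in> W} = (\<Union>i. {t\<in>J. c t \<in> cdom A i} \<inter> (chart A i \<circ> c) -` (chart A i ` (W \<inter> cdom A i)))"
  proof (intro equalityI subsetI)
    fix t assume "t \<in> {t\<in>J. c t \<in> W}"
    moreover from this obtain i where "c t \<in> cdom A i"
      using smooth_curveD(1)[OF c] by (auto simp: carrier_iff)
    ultimately show "t \<in> (\<Union>i. {t\<in>J. c t \<in> cdom A i} \<inter> (chart A i \<circ> c) -` (chart A i ` (W \<inter> cdom A i)))"
      by auto
  next
    fix t assume "t \<in> (\<Union>i. {t\<in>J. c t \<in> cdom A i} \<inter> (chart A i \<circ> c) -` (chart A i ` (W \<inter> cdom A i)))"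
    then show "t \<in> {t\<in>J. c t \<in> W}"
      using smooth_atlasD(1)[OF A] by (auto simp: inj_on_def)
  qed
  moreover have "open ({t\<in>J. c t \<in> cdom A i} \<inter> (chart A i \<circ> c) -` (chart A i ` (W \<inter> cdom A i)))" for i
    by (intro continuous_open_preimage smooth_on_imp_continuous_on smooth_curveD[OF c] openin_chart_image[OF A W])
  ultimately show ?thesis by auto
qed

text \<open>Tangent spaces and tangent maps are defined by curves through a point at parameter 0, so
  a curve has to be shifted before its velocity at time \<open>t\<close> can be used there.\<close>

lemma smooth_curve_translate:
  assumes c: "smooth_curve A J c" and J: "open J"
  shows "smooth_curve A ((\<lambda>s. t + s) -` J) (\<lambda>s. c (t + s))"
  unfolding smooth_curve_def
proof (intro conjI allI)
  show "(\<lambda>s. c (t + s)) ` ((\<lambda>s. t + s) -` J) \<subseteq> carrier A" using smooth_curveD(1)[OF c] by auto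
  fix i
  have *: "{s \<in> (\<lambda>s. t + s) -` J. c (t + s) \<in> cdom A i} = (\<lambda>s. t + s) -` {t\<in>J. c t \<in> cdom A i}" by auto
  have add: "smooth_on S (\<lambda>s. t + s)" if "open S" for S :: "real set"
    by (intro smooth_on_add smooth_on_const smooth_on_bounded_linear bounded_linear_ident that)
  show op: "open {s \<in> (\<lambda>s. t + s) -` J. c (t + s) \<in> cdom A i}"
    unfolding * by (intro open_vimage smooth_curveD(2)[OF c] continuous_intros)
  have "smooth_on {s \<in> (\<lambda>s. t + s) -` J. c (t + s) \<in> cdom A i} (\<lambda>s. (chart A i \<circ> c) (t + s))"
    by (rule smooth_on_compose[OF op smooth_curveD(2)[OF c] _ smooth_curveD(3)[OF c] add[OF op]]) auto
  then show "smooth_on {s \<in> (\<lambda>s. t + s) -` J. c (t + s) \<in> cdom A i} (chart A i \<circ> (\<lambda>s. c (t + s)))"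
    by (simp add: o_def)
qed

lemma vector_derivative_translate:
  assumes "f differentiable (at t)"
  shows "vector_derivative (\<lambda>s. f (t + s)) (at 0) = vector_derivative f (at (t::real))"
proof -
  have "(f has_vector_derivative vector_derivative f (at t)) (at t)"
    using assms vector_derivative_works by blast
  moreover have "((\<lambda>s. t + s) has_vector_derivative 1) (at 0)"
    by (auto simp: has_vector_derivative_def intro!: derivative_eq_intros)
  ultimately have "((\<lambda>s. f (t + s)) has_vector_derivative vector_derivative f (at t)) (at 0)"
    using vector_diff_chain_at[of "\<lambda>s. t + s" 1 0 f "vector_derivative f (at t)"]
    by (simp add: o_def)
  then show ?thesis by (rule vector_derivative_at)
qed

lemma smooth_curve_has_vector_derivative:
  assumes c: "smooth_curve A J c" and t: "t \<in> J" "c t \<in> cdom A i"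
  shows "((chart A i \<circ> c) has_vector_derivative snd (velocity A c t) i) (at t)"
proof -
  have "chart A i \<circ> c differentiable (at t)"
    using smooth_on_has_derivative[OF smooth_curveD(3)[OF c]] t differentiable_def by blast
  with t show ?thesis by (simp add: velocity_def vector_derivative_works)
qed

lemma velocity_translate:
  assumes c: "smooth_curve A J c" and t: "t \<in> J"
  shows "velocity A (\<lambda>s. c (t + s)) 0 = velocity A c t"
proof -
  have "vector_derivative (chart A i \<circ> (\<lambda>s. c (t + s))) (at 0) = vector_derivative (chart A i \<circ> c) (at t)"
    if "c t \<in> cdom A i" for i
    using vector_derivative_translate[of "chart A i \<circ> c" t] smooth_curve_has_vector_derivative[OF c t that]
    by (auto simp: o_def differentiableI_vector)
  then show ?thesis by (auto simp: velocity_def)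
qed

lemma germ_curve_translate:
  assumes c: "smooth_curve A J c" and J: "open J" "t \<in> J" and X: "c ` J \<subseteq> X"
  shows "germ_curve_in A X (\<lambda>s. c (t + s))"
proof -
  obtain e where e: "e > 0" "ball t e \<subseteq> J" using J openE by blast
  have sub: "{-e<..<e} \<subseteq> (\<lambda>s. t + s) -` J"
    using e by (auto simp: dist_real_def subset_iff)
  show ?thesis
    unfolding germ_curve_in_def
    by (intro exI[of _ e] conjI smooth_curve_subset[OF smooth_curve_translate[OF c J(1), of t] _ sub])
      (use e X sub in auto)
qed

text \<open>\<Gamma> is represented by curves in \<open>M\<close>, but \<open>F\<close> lives on
  \<open>M \<inter> W\<close>: the representing curve is shortened until it stays in
  \<open>W\<close>, which leaves its velocity at 0 unchanged.\<close>

lemma germ_curve_in_open: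
  assumes A: "smooth_atlas A" and g: "germ_curve_in A X g" "g 0 \<in> W" and W: "openin (mtopology A) W"
  shows "germ_curve_in A (X \<inter> W) g"
proof -
  obtain e where e: "e > 0" "smooth_curve A {-e<..<e} g" "g ` {-e<..<e} \<subseteq> X"
    using g by (auto simp: germ_curve_in_def)
  let ?J = "{t\<in>{-e<..<e}. g t \<in> W}"
  have J: "open ?J" by (rule smooth_curve_open_preimage[OF A e(2) W])
  \<comment> \<open>The shift by 0 only serves to extract a symmetric interval around 0 from the
    open set \<open>?J\<close>.\<close>
  have "germ_curve_in A (X \<inter> W) (\<lambda>s. g (0 + s))"
    by (rule germ_curve_translate[OF smooth_curve_subset[OF e(2) J] J]) (use e g in auto)
  then show ?thesis by simp
qed

section \<open>Tangent maps of smooth maps on submanifolds\<close>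

lemma smooth_map_onE:
  assumes "smooth_map_on A X B f" "x \<in> X" "x \<in> cdom A i" "f x \<in> cdom B j"
  obtains W g where "open W" "chart A i x \<in> W" "W \<subseteq> chart A i ` cdom A i" "smooth_on W g"
    "\<And>y. y \<in> X \<Longrightarrow> y \<in> cdom A i \<Longrightarrow> chart A i y \<in> W \<Longrightarrow> f y \<in> cdom B j \<and> chart B j (f y) = g (chart A i y)"
  using assms unfolding smooth_map_on_def by (metis IntI)

lemma smooth_curve_smooth_map:
  fixes A :: "('a, 'i, 'e::euclidean_space) atlas" and B :: "('b, 'j, 'f::euclidean_space) atlas"
  assumes f: "smooth_map_on A X B f" and c: "smooth_curve A J c" "c ` J \<subseteq> X"
  shows "smooth_curve B J (f \<circ> c)"
proof -
  have loc: "\<exists>T. open T \<and> t \<in> T \<and> T \<subseteq> {t\<in>J. (f \<circ> c) t \<in> cdom B j} \<and> smooth_on T (chart B j \<circ> (f \<circ> c))"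
    if t: "t \<in> J" "(f \<circ> c) t \<in> cdom B j" for t j
  proof -
    obtain i where i: "c t \<in> cdom A i" using smooth_curveD(1)[OF c(1)] t by (auto simp: carrier_iff)
    have ft: "f (c t) \<in> cdom B j" using t by simp
    from c(2) t(1) have ct: "c t \<in> X" by auto
    obtain W g where W: "open W" "chart A i (c t) \<in> W" "smooth_on W g"
      "\<And>y. y \<in> X \<Longrightarrow> y \<in> cdom A i \<Longrightarrow> chart A i y \<in> W \<Longrightarrow> f y \<in> cdom B j \<and> chart B j (f y) = g (chart A i y)"
      using smooth_map_onE[OF f ct i ft] by metis
    let ?T = "{t\<in>J. c t \<in> cdom A i} \<inter> (chart A i \<circ> c) -` W"
    have T: "open ?T"
      by (intro continuous_open_preimage smooth_on_imp_continuous_on smooth_curveD[OF c(1)] W)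
    have "smooth_on ?T (\<lambda>t. g ((chart A i \<circ> c) t))"
      by (rule smooth_on_compose[OF T W(1) _ W(3) smooth_on_subset[OF smooth_curveD(3)[OF c(1)]]]) auto
    then have "smooth_on ?T (chart B j \<circ> (f \<circ> c))"
      by (rule smooth_on_cong[OF T, rotated]) (use W(4) c(2) in auto)
    moreover have "?T \<subseteq> {t\<in>J. (f \<circ> c) t \<in> cdom B j}" using W(4) c(2) by auto
    ultimately show ?thesis using T t i W(2) by (intro exI[of _ ?T]) auto
  qed
  show ?thesis
    unfolding smooth_curve_def
  proof (intro conjI allI)
    show "(f \<circ> c) ` J \<subseteq> carrier B" using f c(2) by (auto simp: smooth_map_on_def)
    fix j
    show "open {t\<in>J. (f \<circ> c) t \<in> cdom B j}"
      unfolding open_subopen[of "{t\<in>J. (f \<circ> c) t \<in> cdom B j}"] using loc by blast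
    show "smooth_on {t\<in>J. (f \<circ> c) t \<in> cdom B j} (chart B j \<circ> (f \<circ> c))"
      by (rule smooth_on_locally) (use loc in blast)
  qed
qed

text \<open>Chain rule with a local extension \<open>g\<close> of \<open>f\<close> in coordinates.
  The extension depends on the point and the charts, not on the curve, so the velocity of
  \<open>f \<circ> c\<close> depends on \<open>c\<close> only through its velocity.\<close>

lemma smooth_map_velocity:
  assumes c: "smooth_curve A J c" "c ` J \<subseteq> X" and t: "t \<in> J" "c t \<in> cdom A i"
    and W: "open W" "chart A i (c t) \<in> W" "smooth_on W g"
      "\<And>y. y \<in> X \<Longrightarrow> y \<in> cdom A i \<Longrightarrow> chart A i y \<in> W \<Longrightarrow> f y \<in> cdom B j \<and> chart B j (f y) = g (chart A i y)"
  shows "snd (velocity B (f \<circ> c) t) j = frechet_derivative g (at (chart A i (c t))) (snd (velocity A c t) i)"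
proof -
  let ?T = "{t\<in>J. c t \<in> cdom A i} \<inter> (chart A i \<circ> c) -` W"
  have T: "open ?T"
    by (intro continuous_open_preimage smooth_on_imp_continuous_on smooth_curveD[OF c(1)] W)
  have tT: "t \<in> ?T" using t W by simp
  have "((\<lambda>s. g ((chart A i \<circ> c) s)) has_derivative
      (\<lambda>h. frechet_derivative g (at (chart A i (c t))) (h *\<^sub>R snd (velocity A c t) i))) (at t)"
    using has_derivative_compose[OF smooth_curve_has_vector_derivative[OF c(1) t, unfolded has_vector_derivative_def], of g]
      smooth_on_has_derivative[OF W(3,2)] by simp
  then have "((\<lambda>s. g ((chart A i \<circ> c) s)) has_vector_derivative
      frechet_derivative g (at (chart A i (c t))) (snd (velocity A c t) i)) (at t)"
    using linear_scale[OF has_derivative_linear[OF smooth_on_has_derivative[OF W(3,2)]]]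
    by (simp add: has_vector_derivative_def)
  then have "((chart B j \<circ> (f \<circ> c)) has_vector_derivative
      frechet_derivative g (at (chart A i (c t))) (snd (velocity A c t) i)) (at t)"
    by (rule has_vector_derivative_transform_within_open[OF _ T tT]) (use W(4) c(2) in auto)
  moreover have "f (c t) \<in> cdom B j" using W t c by blast
  ultimately show ?thesis by (simp add: velocity_def vector_derivative_at)
qed

lemma fst_velocity [simp]: "fst (velocity A c t) = c t"
  by (simp add: velocity_def)

lemma snd_velocity_notin: "c t \<notin> cdom A i \<Longrightarrow> snd (velocity A c t) i = 0"
  by (simp add: velocity_def)

text \<open>This is the uniqueness behind the definite description in \<open>tangent_map\<close>.
  One extension serves both curves, and in charts not containing the image point both components
  have the default value 0.\<close>

lemma smooth_map_velocity_eq: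
  fixes A :: "('a, 'i, 'e::euclidean_space) atlas" and B :: "('b, 'j, 'f::euclidean_space) atlas"
  assumes f: "smooth_map_on A X B f" and g: "germ_curve_in A X g" "germ_curve_in A X g'"
    and eq: "velocity A g 0 = velocity A g' 0"
  shows "velocity B (f \<circ> g) 0 = velocity B (f \<circ> g') 0"
proof -
  obtain e where e: "e > 0" "smooth_curve A {-e<..<e} g" "g ` {-e<..<e} \<subseteq> X"
    using g by (auto simp: germ_curve_in_def)
  obtain e' where e': "e' > 0" "smooth_curve A {-e'<..<e'} g'" "g' ` {-e'<..<e'} \<subseteq> X"
    using g by (auto simp: germ_curve_in_def)
  have g0: "g 0 = g' 0" using arg_cong[OF eq, of fst] by simp
  have X: "g 0 \<in> X" using e by auto
  obtain i where i: "g 0 \<in> cdom A i" using smooth_curveD(1)[OF e(2), of 0] e(1) by (auto simp: carrier_iff)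
  have "snd (velocity B (f \<circ> g) 0) j = snd (velocity B (f \<circ> g') 0) j" for j
  proof (cases "f (g 0) \<in> cdom B j")
    case True
    obtain W h where W: "open W" "chart A i (g 0) \<in> W" "smooth_on W h"
      "\<And>y. y \<in> X \<Longrightarrow> y \<in> cdom A i \<Longrightarrow> chart A i y \<in> W \<Longrightarrow> f y \<in> cdom B j \<and> chart B j (f y) = h (chart A i y)"
      using smooth_map_onE[OF f X i True] by metis
    show ?thesis
      using smooth_map_velocity[OF e(2,3) _ i W] smooth_map_velocity[OF e'(2,3) _ i[unfolded g0] W(1) W(2)[unfolded g0] W(3,4)]
        e(1) e'(1) eq g0 by simp
  next
    case False
    then show ?thesis by (simp add: snd_velocity_notin g0[symmetric])
  qed
  with g0 show ?thesis by (intro prod_eqI ext) auto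
qed

lemma tangent_map_velocity:
  assumes f: "smooth_map_on A X B f" and g: "germ_curve_in A X g"
  shows "tangent_map A X B f (velocity A g 0) = velocity B (f \<circ> g) 0"
  unfolding tangent_map_def
proof (rule the_equality)
  show "\<exists>g'. germ_curve_in A X g' \<and> velocity A g' 0 = velocity A g 0 \<and> velocity B (f \<circ> g) 0 = velocity B (f \<circ> g') 0"
    using g by blast
  fix z assume "\<exists>g'. germ_curve_in A X g' \<and> velocity A g' 0 = velocity A g 0 \<and> z = velocity B (f \<circ> g') 0"
  then show "z = velocity B (f \<circ> g) 0" using smooth_map_velocity_eq[OF f _ g] by blast
qed

section \<open>Isotropic sections over a submanifold\<close>

text \<open>In slice coordinates \<phi> the submanifold is a linear subspace \<open>V\<close>, onto
  which there is a linear projection \<open>P\<close>; \<open>R\<close> is \<open>P\<close>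
  conjugated by \<phi>.\<close>

lemma submanifold_retraction:
  fixes A :: "('a, 'i, 'e::euclidean_space) atlas"
  assumes M: "submanifold A k M" and x: "x \<in> M"
  obtains i T R where "x \<in> cdom A i" "open T" "chart A i x \<in> T" "T \<subseteq> chart A i ` cdom A i"
    "smooth_on T R" "R ` T \<subseteq> chart A i ` (M \<inter> cdom A i)"
    "\<And>y. y \<in> chart A i ` (M \<inter> cdom A i) \<Longrightarrow> y \<in> T \<Longrightarrow> R y = y"
proof -
  obtain i W and \<phi> :: "'e \<Rightarrow> 'e" and V where i: "x \<in> cdom A i" and W: "open W" "chart A i x \<in> W"
    "W \<subseteq> chart A i ` cdom A i" and \<phi>: "inj_on \<phi> W" "smooth_on W \<phi>" "open (\<phi> ` W)"
    "smooth_on (\<phi> ` W) (inv_into W \<phi>)" and V: "subspace V"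
    and slice: "\<phi> ` (chart A i ` (M \<inter> cdom A i) \<inter> W) = \<phi> ` W \<inter> V"
    using M x unfolding submanifold_def by metis
  \<comment> \<open>A left inverse, with range in \<open>V\<close>, of the identity restricted to
    \<open>V\<close> is a projection onto \<open>V\<close>.\<close>
  have "\<exists>P::'e \<Rightarrow> 'e. range P \<subseteq> V \<and> linear P \<and> (\<forall>v\<in>V. P (id v) = v)"
    by (rule linear_exists_left_inverse_on[OF linear_id V]) simp
  then obtain P :: "'e \<Rightarrow> 'e" where P: "range P \<subseteq> V" "linear P" "\<And>v. v \<in> V \<Longrightarrow> P v = v" by auto
  have bP: "bounded_linear P" using P(2) by (simp add: linear_conv_bounded_linear)
  let ?C = "chart A i ` (M \<inter> cdom A i)"
  \<comment> \<open>Projecting may leave the image of the slice chart; the domain is cut down to the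
    points where \<phi> can be inverted afterwards.\<close>
  let ?T = "W \<inter> (\<lambda>y. P (\<phi> y)) -` (\<phi> ` W)"
  let ?R = "\<lambda>y. inv_into W \<phi> (P (\<phi> y))"
  have smP: "smooth_on W (\<lambda>y. P (\<phi> y))"
    by (rule smooth_on_linear_compose[OF W(1) bP \<phi>(2)])
  have T: "open ?T"
    by (rule continuous_open_preimage[OF smooth_on_imp_continuous_on[OF smP] W(1) \<phi>(3)])
  have C: "P (\<phi> y) = \<phi> y" if "y \<in> ?C" "y \<in> W" for y
    using slice that by (intro P(3)) blast
  show thesis
  proof (rule that[OF i T, of ?R])
    have "chart A i x \<in> ?C" using x i by blast
    with C[OF this W(2)] W(2) show "chart A i x \<in> ?T" by simp
    show "?T \<subseteq> chart A i ` cdom A i" using W(3) by blast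
    show "smooth_on ?T ?R"
      by (rule smooth_on_compose[OF T \<phi>(3) _ \<phi>(4) smooth_on_subset[OF smP]]) auto
    show "?R ` ?T \<subseteq> ?C"
    proof (rule image_subsetI)
      fix y assume "y \<in> ?T"
      then have y: "y \<in> W" "P (\<phi> y) \<in> \<phi> ` W" by auto
      then have "P (\<phi> y) \<in> \<phi> ` (?C \<inter> W)" unfolding slice using P(1) by blast
      then obtain y' where y': "y' \<in> ?C" "y' \<in> W" "P (\<phi> y) = \<phi> y'" by blast
      then have "?R y = y'" using \<phi>(1) by simp
      with y' show "?R y \<in> ?C" by blast
    qed
    show "?R y = y" if "y \<in> ?C" "y \<in> ?T" for y
      using C[OF that(1)] that(2) \<phi>(1) by simp
  qed
qed

lemma cotangent_vectors_transition:
  assumes "l \<in> cotangent_vectors A p" "p \<in> cdom A i" "p \<in> cdom A j"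
  shows "l i \<bullet> w = l j \<bullet> frechet_derivative (transition A i j) (at (chart A i p)) w"
  using assms unfolding cotangent_vectors_def by blast

text \<open>Since \<open>R\<close> maps into the coordinates of \<open>X\<close>, composing \<theta>
  with \<rho> gives functions on open sets of a Euclidean space, which can be differentiated in the
  ordinary sense. The chart \<open>j\<close> is left arbitrary because the charts used for
  \<open>R\<close> and for evaluating \<theta> may differ.\<close>

lemma section_pullback:
  fixes N :: "('a, 'i, 'e::euclidean_space) atlas" and R :: "'b::euclidean_space \<Rightarrow> 'e"
  assumes N: "smooth_atlas N" and T: "open T" and R: "smooth_on T R" "R ` T \<subseteq> chart N i ` (X \<inter> cdom N i)"
    and \<theta>: "smooth_map_on N X (CB N) (\<lambda>y. (y, \<theta> y))"
  defines "\<rho> \<equiv> \<lambda>z. chart_inv N i (R z)"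
  shows "z \<in> T \<Longrightarrow> \<rho> z \<in> X \<and> \<rho> z \<in> cdom N i \<and> chart N i (\<rho> z) = R z"
    and "z \<in> T \<Longrightarrow> \<theta> (\<rho> z) \<in> cotangent_vectors N (\<rho> z)"
    and "open {z\<in>T. \<rho> z \<in> cdom N j}"
    and "smooth_on {z\<in>T. \<rho> z \<in> cdom N j} (\<lambda>z. chart N j (\<rho> z))"
    and "smooth_on {z\<in>T. \<rho> z \<in> cdom N j} (\<lambda>z. \<theta> (\<rho> z) j)"
proof -
  have \<rho>: "\<rho> z \<in> X \<and> \<rho> z \<in> cdom N i \<and> chart N i (\<rho> z) = R z" if "z \<in> T" for z
  proof -
    have "R z \<in> chart N i ` (X \<inter> cdom N i)" using R(2) that by blast
    then obtain y where "y \<in> X" "y \<in> cdom N i" "R z = chart N i y" by blast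
    moreover from this have "\<rho> z = y" unfolding \<rho>_def by (simp only: chart_inv_chart[OF N])
    ultimately show ?thesis by (simp only: simp_thms)
  qed
  then show "z \<in> T \<Longrightarrow> \<rho> z \<in> X \<and> \<rho> z \<in> cdom N i \<and> chart N i (\<rho> z) = R z" .
  show cot: "\<theta> (\<rho> z) \<in> cotangent_vectors N (\<rho> z)" if "z \<in> T" for z
  proof -
    have "(\<rho> z, \<theta> (\<rho> z)) \<in> carrier (CB N)" using \<theta> \<rho>[OF that] unfolding smooth_map_on_def by blast
    then show ?thesis by (auto simp: carrier_iff)
  qed
  let ?S = "chart N i ` (cdom N i \<inter> cdom N j)"
  let ?T = "{z\<in>T. \<rho> z \<in> cdom N j}"
  have eq: "?T = T \<inter> R -` ?S"
  proof (intro equalityI subsetI)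
    fix z assume "z \<in> ?T"
    then have "z \<in> T" "\<rho> z \<in> cdom N i \<inter> cdom N j" "R z = chart N i (\<rho> z)" using \<rho> by auto
    then show "z \<in> T \<inter> R -` ?S" by blast
  next
    fix z assume "z \<in> T \<inter> R -` ?S"
    then show "z \<in> ?T" by (auto simp: \<rho>_def chart_inv_chart[OF N])
  qed
  show op: "open ?T"
    unfolding eq by (rule continuous_open_preimage[OF smooth_on_imp_continuous_on[OF R(1)] T smooth_atlasD(2)[OF N]])
  have "smooth_on ?T (\<lambda>z. transition N i j (R z))"
    by (rule smooth_on_compose[OF op smooth_atlasD(2)[OF N] _ smooth_atlasD(3)[OF N] smooth_on_subset[OF R(1)]])
      (auto simp: eq)
  then show sm: "smooth_on ?T (\<lambda>z. chart N j (\<rho> z))"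
    by (simp add: transition_def \<rho>_def)
  show "smooth_on ?T (\<lambda>z. \<theta> (\<rho> z) j)"
  proof (rule smooth_on_locally)
    fix z assume z: "z \<in> ?T"
    then have X: "\<rho> z \<in> X" and j: "\<rho> z \<in> cdom N j" "(\<rho> z, \<theta> (\<rho> z)) \<in> cdom (CB N) j"
      using \<rho> cot by auto
    obtain W g where W: "open W" "chart N j (\<rho> z) \<in> W" "smooth_on W g"
      "\<And>y. y \<in> X \<Longrightarrow> y \<in> cdom N j \<Longrightarrow> chart N j y \<in> W \<Longrightarrow>
        (y, \<theta> y) \<in> cdom (CB N) j \<and> chart (CB N) j (y, \<theta> y) = g (chart N j y)"
      using smooth_map_onE[OF \<theta> X j] by metis
    let ?U = "?T \<inter> (\<lambda>z. chart N j (\<rho> z)) -` W"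
    have U: "open ?U"
      by (rule continuous_open_preimage[OF smooth_on_imp_continuous_on[OF sm] op W(1)])
    have "smooth_on ?U (\<lambda>z. snd (g (chart N j (\<rho> z))))"
      by (intro smooth_on_linear_compose[OF U bounded_linear_snd]
          smooth_on_compose[OF U W(1) _ W(3) smooth_on_subset[OF sm]]) auto
    then have "smooth_on ?U (\<lambda>z. \<theta> (\<rho> z) j)"
    proof (rule smooth_on_cong[OF U, rotated])
      fix z' assume "z' \<in> ?U"
      then have "chart (CB N) j (\<rho> z', \<theta> (\<rho> z')) = g (chart N j (\<rho> z'))" using W(4) \<rho> by blast
      then show "snd (g (chart N j (\<rho> z'))) = \<theta> (\<rho> z') j" by (metis chart_CB snd_conv)
    qed
    then show "\<exists>U. open U \<and> z \<in> U \<and> smooth_on U (\<lambda>z. \<theta> (\<rho> z) j)"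
      using U z W(2) by blast
  qed
qed

text \<open>\<open>a\<close> represents the pulled-back form by the inner product. Writing it as
  \<open>e \<bullet> dr\<close>, its exterior derivative on \<open>u\<close>, \<open>w\<close> is
  \<open>De u \<bullet> Dr w - De w \<bullet> Dr u\<close>. Up to sign this is the symplectic form
  on the vectors \<open>(Dr u, De u)\<close> and \<open>(Dr w, De w)\<close>, which are tangent to
  the isotropic image.\<close>

lemma isotropic_pullback_closed:
  fixes N :: "('a, 'i, 'e::euclidean_space) atlas" and R :: "'b::euclidean_space \<Rightarrow> 'e"
  assumes N: "smooth_atlas N" and T: "open T" and R: "smooth_on T R" "R ` T \<subseteq> chart N i ` (X \<inter> cdom N i)"
    and \<theta>: "smooth_map_on N X (CB N) (\<lambda>y. (y, \<theta> y))"
    and iso: "isotropic_submanifold N ((\<lambda>y. (y, \<theta> y)) ` X)" and z: "z \<in> T"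
  defines "a \<equiv> \<lambda>z. \<Sum>b\<in>Basis. (\<theta> (chart_inv N i (R z)) i \<bullet> frechet_derivative R (at z) b) *\<^sub>R b"
  shows "smooth_on T a"
    and "z' \<in> T \<Longrightarrow> a z' \<bullet> w = \<theta> (chart_inv N i (R z')) i \<bullet> frechet_derivative R (at z') w"
    and "frechet_derivative a (at z) u \<bullet> w = frechet_derivative a (at z) w \<bullet> u"
proof -
  define \<rho> where "\<rho> z = chart_inv N i (R z)" for z
  note pb = section_pullback[OF N T R \<theta>, folded \<rho>_def]
  have T_eq: "{z\<in>T. \<rho> z \<in> cdom N i} = T" using pb(1) by blast
  show a_smooth: "smooth_on T a"
    unfolding a_def
    by (intro smooth_on_sum T smooth_on_bilinear[OF T bounded_bilinear_scaleR] smooth_on_const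
        smooth_on_bilinear[OF T bounded_bilinear_inner] smooth_on_frechet_derivative[OF R(1)]
        pb(5)[of i, unfolded T_eq, unfolded \<rho>_def])
  show a_inner: "a z' \<bullet> w = \<theta> (chart_inv N i (R z')) i \<bullet> frechet_derivative R (at z') w" if "z' \<in> T" for z' w
  proof -
    have lin: "linear (frechet_derivative R (at z'))"
      by (rule has_derivative_linear[OF smooth_on_has_derivative[OF R(1) that]])
    show ?thesis
      unfolding a_def linear_Basis_expansion[OF lin, of w]
      by (simp add: inner_sum_left inner_sum_right inner_commute mult.commute)
  qed
  \<comment> \<open>\<open>symplectic_form\<close> is evaluated in a chart \<open>j\<close> that varies with the base point and need not be \<open>i\<close>;
    near \<open>z\<close> the pullback \<open>a\<close> is therefore rewritten in chart \<open>j\<close> before it is differentiated.\<close>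
  define j where "j = (SOME j. (\<rho> z, \<theta> (\<rho> z)) \<in> cdom (CB N) j)"
  have "(\<rho> z, \<theta> (\<rho> z)) \<in> cdom (CB N) i" using pb(1,2)[OF z] by simp
  then have j: "(\<rho> z, \<theta> (\<rho> z)) \<in> cdom (CB N) j" unfolding j_def by (rule someI)
  let ?T = "{z\<in>T. \<rho> z \<in> cdom N j}"
  define r where "r = (\<lambda>z. chart N j (\<rho> z))"
  define e where "e = (\<lambda>z. \<theta> (\<rho> z) j)"
  have zT: "z \<in> ?T" using z j by simp
  have op: "open ?T" and r: "smooth_on ?T r" and e: "smooth_on ?T e"
    unfolding r_def e_def by (rule pb)+
  have a_eq: "a z' \<bullet> w = e z' \<bullet> frechet_derivative r (at z') w" if z': "z' \<in> ?T" for z' w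
  proof -
    have i: "\<rho> z' \<in> cdom N i" "\<rho> z' \<in> cdom N j" "R z' = chart N i (\<rho> z')"
      and cot: "\<theta> (\<rho> z') \<in> cotangent_vectors N (\<rho> z')" using pb(1,2) z' by auto
    have "((\<lambda>z. transition N i j (R z)) has_derivative
        (\<lambda>w. frechet_derivative (transition N i j) (at (R z')) (frechet_derivative R (at z') w))) (at z')"
      using z' by (intro has_derivative_compose[OF smooth_on_has_derivative[OF R(1)]])
        (auto simp: i(3) intro: transition_has_derivative[OF N i(1,2)])
    moreover have "(\<lambda>z. transition N i j (R z)) = r"
      by (auto simp: r_def transition_def \<rho>_def)
    ultimately have "frechet_derivative r (at z') w =
        frechet_derivative (transition N i j) (at (R z')) (frechet_derivative R (at z') w)"
      by (simp add: frechet_derivative_eq)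
    moreover have "\<theta> (\<rho> z') i \<bullet> v =
        \<theta> (\<rho> z') j \<bullet> frechet_derivative (transition N i j) (at (R z')) v" for v
      unfolding i(3) by (rule cotangent_vectors_transition[OF cot i(1,2)])
    ultimately show ?thesis
      using a_inner[of z' w] z' unfolding e_def \<rho>_def[symmetric] by simp
  qed
  let ?\<sigma> = "\<lambda>y. (y, \<theta> y)"
  \<comment> \<open>The tangent vector belonging to \<open>u\<close> is the velocity of the straight
    line through \<open>z\<close> in direction \<open>u\<close>, carried to \<open>X\<close> by
    \<rho> and then into the image by the section.\<close>
  have tangent: "\<exists>\<xi>\<in>tangent_space (CB N) (?\<sigma> ` X) (?\<sigma> (\<rho> z)).
      fst \<xi> = ?\<sigma> (\<rho> z) \<and> snd \<xi> j = (frechet_derivative r (at z) u, frechet_derivative e (at z) u)" for u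
  proof -
    define \<gamma> where "\<gamma> = (\<lambda>s::real. z + s *\<^sub>R u)"
    have J: "open (\<gamma> -` T)" unfolding \<gamma>_def by (intro open_vimage T continuous_intros)
    have \<gamma>: "smooth_on S \<gamma>" if "open S" for S
      unfolding \<gamma>_def
      by (intro smooth_on_add smooth_on_const smooth_on_bounded_linear that bounded_linear_scaleR_left)
    have "smooth_on (\<gamma> -` T) (\<lambda>s. R (\<gamma> s))"
      by (rule smooth_on_compose[OF J T _ R(1) \<gamma>[OF J]]) auto
    then have c: "smooth_curve N (\<gamma> -` T) (\<lambda>s. \<rho> (\<gamma> s))"
      unfolding \<rho>_def using R(2) by (intro smooth_curve_chart_inv[OF N J]) auto
    have cX: "(\<lambda>s. \<rho> (\<gamma> s)) ` (\<gamma> -` T) \<subseteq> X" using pb(1) by blast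
    have \<sigma>c: "smooth_curve (CB N) (\<gamma> -` T) (?\<sigma> \<circ> (\<lambda>s. \<rho> (\<gamma> s)))"
      by (rule smooth_curve_smooth_map[OF \<theta> c cX])
    have \<gamma>0: "\<gamma> 0 = z" by (simp add: \<gamma>_def)
    have "germ_curve_in (CB N) (?\<sigma> ` X) (\<lambda>s. (?\<sigma> \<circ> (\<lambda>s. \<rho> (\<gamma> s))) (0 + s))"
      by (rule germ_curve_translate[OF \<sigma>c J]) (use cX z \<gamma>0 in auto)
    then have germ: "germ_curve_in (CB N) (?\<sigma> ` X) (?\<sigma> \<circ> (\<lambda>s. \<rho> (\<gamma> s)))" by (simp add: o_def)
    have \<gamma>': "(\<gamma> has_derivative (\<lambda>h. h *\<^sub>R u)) (at 0)"
      unfolding \<gamma>_def by (auto intro!: derivative_eq_intros)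
    have along: "((\<lambda>s. h (\<gamma> s)) has_vector_derivative frechet_derivative h (at z) u) (at 0)"
      if h: "smooth_on ?T h" for h :: "'b \<Rightarrow> 'e"
      using has_derivative_compose[OF \<gamma>', of h "frechet_derivative h (at z)"]
        smooth_on_has_derivative[OF h zT] linear_scale[OF has_derivative_linear[OF smooth_on_has_derivative[OF h zT]]]
      by (simp add: \<gamma>0 has_vector_derivative_def)
    have "((\<lambda>s. (r (\<gamma> s), e (\<gamma> s))) has_vector_derivative
        (frechet_derivative r (at z) u, frechet_derivative e (at z) u)) (at 0)"
      by (intro has_vector_derivative_Pair along r e)
    then have "snd (velocity (CB N) (?\<sigma> \<circ> (\<lambda>s. \<rho> (\<gamma> s))) 0) j =
        (frechet_derivative r (at z) u, frechet_derivative e (at z) u)"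
      using j by (simp add: velocity_def \<gamma>0 o_def r_def e_def vector_derivative_at)
    moreover have "velocity (CB N) (?\<sigma> \<circ> (\<lambda>s. \<rho> (\<gamma> s))) 0 \<in> tangent_space (CB N) (?\<sigma> ` X) (?\<sigma> (\<rho> z))"
      using germ \<gamma>0 unfolding tangent_space_def by force
    ultimately show ?thesis by (intro bexI) (auto simp: \<gamma>0)
  qed
  have symp: "frechet_derivative r (at z) u \<bullet> frechet_derivative e (at z) w =
      frechet_derivative e (at z) u \<bullet> frechet_derivative r (at z) w" for u w
  proof -
    obtain \<xi> where \<xi>: "\<xi> \<in> tangent_space (CB N) (?\<sigma> ` X) (?\<sigma> (\<rho> z))" "fst \<xi> = ?\<sigma> (\<rho> z)"
      "snd \<xi> j = (frechet_derivative r (at z) u, frechet_derivative e (at z) u)" using tangent by blast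
    obtain \<eta> where \<eta>: "\<eta> \<in> tangent_space (CB N) (?\<sigma> ` X) (?\<sigma> (\<rho> z))"
      "snd \<eta> j = (frechet_derivative r (at z) w, frechet_derivative e (at z) w)" using tangent by blast
    have "?\<sigma> (\<rho> z) \<in> ?\<sigma> ` X" using pb(1)[OF z] by blast
    then have "symplectic_form N \<xi> \<eta> = 0"
      using iso \<xi>(1) \<eta>(1) unfolding isotropic_submanifold_def by blast
    then show ?thesis unfolding symplectic_form_def Let_def \<xi>(2) j_def[symmetric] \<xi>(3) \<eta>(2) by simp
  qed
  \<comment> \<open>Product rule for \<open>e \<bullet> dr\<close>. The first summand is symmetric
    in \<open>u\<close> and \<open>w\<close> as a second derivative of \<open>r\<close>, the second
    one by \<open>symp\<close>.\<close>
  have Da: "frechet_derivative a (at z) u \<bullet> w = e z \<bullet> frechet_derivative (\<lambda>y. frechet_derivative r (at y) w) (at z) u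
      + frechet_derivative e (at z) u \<bullet> frechet_derivative r (at z) w" for u w
  proof -
    have 1: "((\<lambda>y. a y \<bullet> w) has_derivative (\<lambda>u. frechet_derivative a (at z) u \<bullet> w)) (at z)"
      by (rule has_derivative_inner_left[OF smooth_on_has_derivative[OF a_smooth z]])
    have "((\<lambda>y. e y \<bullet> frechet_derivative r (at y) w) has_derivative
        (\<lambda>u. e z \<bullet> frechet_derivative (\<lambda>y. frechet_derivative r (at y) w) (at z) u
          + frechet_derivative e (at z) u \<bullet> frechet_derivative r (at z) w)) (at z)"
      by (rule has_derivative_inner[OF smooth_on_has_derivative[OF e zT]
          smooth_on_has_derivative[OF smooth_on_frechet_derivative[OF r] zT]])
    then have 2: "((\<lambda>y. a y \<bullet> w) has_derivative
        (\<lambda>u. e z \<bullet> frechet_derivative (\<lambda>y. frechet_derivative r (at y) w) (at z) u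
          + frechet_derivative e (at z) u \<bullet> frechet_derivative r (at z) w)) (at z)"
      by (rule has_derivative_transform_within_open[OF _ op zT]) (simp add: a_eq)
    show ?thesis by (rule fun_cong[OF has_derivative_unique[OF 1 2]])
  qed
  show "frechet_derivative a (at z) u \<bullet> w = frechet_derivative a (at z) w \<bullet> u"
    unfolding Da[of u w] Da[of w u] second_derivative_symmetric[OF op r zT, of u w]
    using symp[of u w] by (simp only: inner_commute)
qed

text \<open>At \<open>z\<close> in the coordinates of \<open>M\<close>, \<open>df\<close>
  contributes \<open>\<theta> \<bullet> DR w\<close> and the correction term
  \<open>\<theta> \<bullet> (w - DR w)\<close>; the remaining term, with the derivative of \<theta>,
  is paired with \<open>z - R z = 0\<close>. The sum is \<open>\<theta> \<bullet> w\<close> for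
  every direction \<open>w\<close>.\<close>

lemma isotropic_section_primitive:
  fixes N :: "('a, 'i, 'e::euclidean_space) atlas"
  assumes N: "smooth_atlas N" and M: "submanifold N k M"
    and W: "openin (mtopology N) W" and x: "x \<in> M" "x \<in> W"
    and \<theta>: "smooth_map_on N (M \<inter> W) (CB N) (\<lambda>y. (y, \<theta> y))"
    and iso: "isotropic_submanifold N ((\<lambda>y. (y, \<theta> y)) ` (M \<inter> W))"
  obtains U L where "openin (mtopology N) U" "x \<in> U" "U \<subseteq> W" "smooth_function_on N U L"
    "\<And>y j. y \<in> M \<Longrightarrow> y \<in> U \<Longrightarrow> y \<in> cdom N j \<Longrightarrow>
      ((L \<circ> chart_inv N j) has_derivative (\<lambda>w. \<theta> y j \<bullet> w)) (at (chart N j y))"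
proof -
  obtain i T R where i: "x \<in> cdom N i" and T: "open T" "chart N i x \<in> T" "T \<subseteq> chart N i ` cdom N i"
    and R: "smooth_on T R" "R ` T \<subseteq> chart N i ` (M \<inter> cdom N i)"
    and R_id: "\<And>y. y \<in> chart N i ` (M \<inter> cdom N i) \<Longrightarrow> y \<in> T \<Longrightarrow> R y = y"
    using submanifold_retraction[OF M x(1)] by metis
  let ?x = "chart N i x"
  let ?W = "chart N i ` (W \<inter> cdom N i)"
  have W_op: "open ?W" by (rule openin_chart_image(1)[OF N W])
  have "open (T \<inter> R -` ?W)" 
    by (rule continuous_open_preimage[OF smooth_on_imp_continuous_on[OF R(1)] T(1) W_op])
  moreover have "R ?x = ?x" using R_id T(2) x i by blast
  ultimately have "open (T \<inter> R -` ?W \<inter> ?W)" "?x \<in> T \<inter> R -` ?W \<inter> ?W"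
    using W_op T(2) x i by auto
  then obtain \<epsilon> where \<epsilon>: "\<epsilon> > 0" "ball ?x \<epsilon> \<subseteq> T \<inter> R -` ?W \<inter> ?W" by (meson openE)
  define B where "B = ball ?x \<epsilon>"
  have B: "open B" "?x \<in> B" "B \<subseteq> chart N i ` cdom N i" using \<epsilon> T(3) by (auto simp: B_def)
  have RB: "smooth_on B R" using R(1) \<epsilon> by (auto simp: B_def intro: smooth_on_subset)
  have RB_im: "R ` B \<subseteq> chart N i ` ((M \<inter> W) \<inter> cdom N i)"
  proof
    \<comment> \<open>\<open>y\<close> has a preimage in \<open>M\<close> and one in
      \<open>W\<close>; injectivity of the chart makes them the same point.\<close>
    fix y assume "y \<in> R ` B"
    then have "y \<in> chart N i ` (M \<inter> cdom N i)" "y \<in> chart N i ` (W \<inter> cdom N i)"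
      using R(2) \<epsilon>(2) by (auto simp: B_def)
    then show "y \<in> chart N i ` ((M \<inter> W) \<inter> cdom N i)"
      using smooth_atlasD(1)[OF N, of i] by (auto simp: inj_on_def)
  qed
  define \<rho> where "\<rho> z = chart_inv N i (R z)" for z
  define a where "a z = (\<Sum>b\<in>Basis. (\<theta> (\<rho> z) i \<bullet> frechet_derivative R (at z) b) *\<^sub>R b)" for z
  note pb = section_pullback[OF N B(1) RB RB_im \<theta>, folded \<rho>_def]
  note cl = isotropic_pullback_closed[OF N B(1) RB RB_im \<theta> iso, folded \<rho>_def, folded a_def]
  have B_eq: "{z\<in>B. \<rho> z \<in> cdom N i} = B" using pb(1) by blast
  have \<theta>_smooth: "smooth_on B (\<lambda>z. \<theta> (\<rho> z) i)" using pb(5)[of i] unfolding B_eq .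
  obtain f where f: "\<And>z. z \<in> B \<Longrightarrow> (f has_derivative (\<lambda>w. a z \<bullet> w)) (at z)"
    using poincare_ball[of ?x \<epsilon> a] cl(1,3) B(2) unfolding B_def[symmetric] by blast
  have f_smooth: "smooth_on B f"
    by (rule smooth_onI_derivative[OF B(1) f])
      (auto intro!: smooth_on_bilinear[OF B(1) bounded_bilinear_inner] cl(1) smooth_on_const B(1,2))
  define h where "h = (\<lambda>z. f z + \<theta> (\<rho> z) i \<bullet> (z - R z))"
  have h_smooth: "smooth_on B h"
    unfolding h_def
    by (intro smooth_on_add smooth_on_bilinear[OF B(1) bounded_bilinear_inner] smooth_on_diff
        smooth_on_bounded_linear bounded_linear_ident RB B(1) f_smooth \<theta>_smooth)
  let ?U = "{y \<in> cdom N i. chart N i y \<in> B}"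
  show thesis
  proof (rule that)
    show "openin (mtopology N) ?U" by (rule openin_chart_preimage[OF N B(1,3)])
    show "x \<in> ?U" using i B(2) by simp
    show "?U \<subseteq> W"
    proof
      fix y assume y: "y \<in> ?U"
      then have "chart N i y \<in> ?W" using \<epsilon>(2) by (auto simp: B_def)
      with y show "y \<in> W" using smooth_atlasD(1)[OF N, of i] by (auto simp: inj_on_def)
    qed
    show "smooth_function_on N ?U (h \<circ> chart N i)"
      by (rule smooth_function_chart[OF N B(1,3) h_smooth])
  next
    fix y j assume y: "y \<in> M" "y \<in> ?U" "y \<in> cdom N j"
    let ?z = "chart N i y"
    have z: "?z \<in> B" and yi: "y \<in> cdom N i" using y by auto
    have Rz: "R ?z = ?z" using y z \<epsilon>(2) by (intro R_id) (auto simp: B_def)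
    then have \<rho>z: "\<rho> ?z = y" using yi by (simp add: \<rho>_def chart_inv_chart[OF N])
    have cot: "\<theta> y \<in> cotangent_vectors N y" using pb(2)[OF z] by (simp add: \<rho>z)
    have "(h has_derivative (\<lambda>w. a ?z \<bullet> w + (\<theta> (\<rho> ?z) i \<bullet> (w - frechet_derivative R (at ?z) w)
        + frechet_derivative (\<lambda>z. \<theta> (\<rho> z) i) (at ?z) w \<bullet> (?z - R ?z)))) (at ?z)"
      unfolding h_def
      by (intro has_derivative_add f[OF z] has_derivative_inner has_derivative_diff has_derivative_ident
          smooth_on_has_derivative[OF \<theta>_smooth z] smooth_on_has_derivative[OF RB z])
    moreover have "a ?z \<bullet> w = \<theta> y i \<bullet> frechet_derivative R (at ?z) w" for w
      using cl(2)[OF z z, of w] by (simp add: \<rho>z)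
    ultimately have h': "(h has_derivative (\<lambda>w. \<theta> y i \<bullet> w)) (at ?z)"
      by (simp add: Rz \<rho>z inner_diff_right)
    \<comment> \<open>The covector found in chart \<open>i\<close> is moved to chart
      \<open>j\<close>: composition with the transition matches the transformation law of
      \<open>cotangent_vectors\<close>.\<close>
    have "((\<lambda>p. h (transition N j i p)) has_derivative
        (\<lambda>w. \<theta> y i \<bullet> frechet_derivative (transition N j i) (at (chart N j y)) w)) (at (chart N j y))"
      by (rule has_derivative_compose[OF transition_has_derivative[OF N y(3) yi]])
        (simp add: transition_chart[OF N y(3)] h')
    moreover have "\<theta> y i \<bullet> frechet_derivative (transition N j i) (at (chart N j y)) w = \<theta> y j \<bullet> w" for w
      by (rule cotangent_vectors_transition[OF cot y(3) yi, symmetric])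
    ultimately show "((h \<circ> chart N i) \<circ> chart_inv N j has_derivative (\<lambda>w. \<theta> y j \<bullet> w)) (at (chart N j y))"
      by (simp add: transition_def o_def)
  qed
qed

section \<open>Velocity curves and the Tulczyjew section\<close>

text \<open>Assumption \<open>C\<close> says that the components of the velocity form a tangent
  vector; in the application it holds because the velocities lie in \<open>M\<close>.\<close>

lemma smooth_curve_velocity:
  fixes Q :: "('a, 'i, 'e::euclidean_space) atlas"
  assumes c: "smooth_curve Q J c" and C: "velocity Q c ` J \<subseteq> carrier (TB Q)"
  shows "smooth_curve (TB Q) J (velocity Q c)"
  unfolding smooth_curve_def
proof (intro conjI allI)
  show "velocity Q c ` J \<subseteq> carrier (TB Q)" by (rule C)
  fix i
  let ?J = "{t\<in>J. c t \<in> cdom Q i}"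
  have iff: "velocity Q c t \<in> cdom (TB Q) i \<longleftrightarrow> c t \<in> cdom Q i" if "t \<in> J" for t
  proof -
    have "velocity Q c t \<in> carrier (TB Q)" using C that by blast
    then show ?thesis by (simp add: carrier_TB_cdom_iff)
  qed
  then have eq: "{t\<in>J. velocity Q c t \<in> cdom (TB Q) i} = ?J" by blast
  note J = smooth_curveD(2)[OF c, of i] and s = smooth_curveD(3)[OF c, of i]
  show "open {t\<in>J. velocity Q c t \<in> cdom (TB Q) i}" unfolding eq by (rule J)
  show "smooth_on {t\<in>J. velocity Q c t \<in> cdom (TB Q) i} (chart (TB Q) i \<circ> velocity Q c)"
    unfolding eq
  proof (rule smooth_on_cong[OF J])
    show "smooth_on ?J (\<lambda>t. ((chart Q i \<circ> c) t, frechet_derivative (chart Q i \<circ> c) (at t) 1))"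
      by (intro smooth_on_Pair J s smooth_on_frechet_derivative)
    fix t assume t: "t \<in> ?J"
    then have "chart Q i \<circ> c differentiable (at t)"
      using smooth_on_has_derivative[OF s] differentiable_def by blast
    then show "((chart Q i \<circ> c) t, frechet_derivative (chart Q i \<circ> c) (at t) 1) = (chart (TB Q) i \<circ> velocity Q c) t"
      using t by (simp add: velocity_def frechet_derivative_eq_vector_derivative)
  qed
qed

text \<open>A velocity curve satisfies the second-order condition automatically: the base part of
  its own velocity is the velocity it starts from.\<close>

lemma velocity_velocity:
  assumes c: "smooth_curve Q J c" and C: "velocity Q c ` J \<subseteq> carrier (TB Q)"
    and t: "t \<in> J" "c t \<in> cdom Q i"
  shows "fst (snd (velocity (TB Q) (velocity Q c) t) i) = snd (velocity Q c t) i"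
proof -
  have "velocity Q c t \<in> carrier (TB Q)" using C t by blast
  then have "velocity Q c t \<in> cdom (TB Q) i" using t by (simp add: carrier_TB_cdom_iff)
  then have "((chart (TB Q) i \<circ> velocity Q c) has_vector_derivative snd (velocity (TB Q) (velocity Q c) t) i) (at t)"
    by (rule smooth_curve_has_vector_derivative[OF smooth_curve_velocity[OF c C] t(1)])
  from bounded_linear.has_vector_derivative[OF bounded_linear_fst this]
  have "((chart Q i \<circ> c) has_vector_derivative fst (snd (velocity (TB Q) (velocity Q c) t) i)) (at t)"
    by (simp add: chart_TB_eq o_def)
  with smooth_curve_has_vector_derivative[OF c t] show ?thesis
    using vector_derivative_at by metis
qed

text \<open>\<open>F\<close> covers the identity of \<open>Q\<close>, so \<open>F \<circ> c\<close>
  and \<open>c\<close> have the same base coordinates as functions of time.\<close>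

lemma velocity_fibre_map:
  fixes Q :: "('a, 'i, 'e::euclidean_space) atlas"
  assumes F: "smooth_map_on (TB Q) X (CB Q) F" and base: "\<And>y. y \<in> X \<Longrightarrow> fst (F y) = fst y"
    and c: "smooth_curve (TB Q) J c" "c ` J \<subseteq> X" and t: "t \<in> J" "fst (c t) \<in> cdom Q i"
  shows "fst (snd (velocity (CB Q) (F \<circ> c) t) i) = fst (snd (velocity (TB Q) c t) i)"
proof -
  let ?J = "{t\<in>J. c t \<in> cdom (TB Q) i}"
  have ci: "c t \<in> cdom (TB Q) i" using smooth_curveD(1)[OF c(1) t(1)] t(2) by (simp add: carrier_TB_cdom_iff)
  have X: "c t \<in> X" using c t by blast
  have "F (c t) \<in> carrier (CB Q)" using F X by (auto simp: smooth_map_on_def)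
  then have Fi: "(F \<circ> c) t \<in> cdom (CB Q) i" using t(2) base[OF X] by (simp add: carrier_CB_cdom_iff)
  have "((\<lambda>s. fst ((chart (CB Q) i \<circ> (F \<circ> c)) s)) has_vector_derivative
      fst (snd (velocity (CB Q) (F \<circ> c) t) i)) (at t)"
    by (intro bounded_linear.has_vector_derivative[OF bounded_linear_fst]
        smooth_curve_has_vector_derivative[OF smooth_curve_smooth_map[OF F c] t(1) Fi])
  then have 1: "((\<lambda>s. fst ((chart (TB Q) i \<circ> c) s)) has_vector_derivative
      fst (snd (velocity (CB Q) (F \<circ> c) t) i)) (at t)"
    by (rule has_vector_derivative_transform_within_open[OF _ smooth_curveD(2)[OF c(1), of i]])
      (use t ci base[OF subsetD[OF c(2) imageI]] in \<open>auto simp: chart_TB_eq chart_CB_eq\<close>)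
  have 2: "((\<lambda>s. fst ((chart (TB Q) i \<circ> c) s)) has_vector_derivative
      fst (snd (velocity (TB Q) c t) i)) (at t)"
    by (intro bounded_linear.has_vector_derivative[OF bounded_linear_fst]
        smooth_curve_has_vector_derivative[OF c(1) t(1) ci])
  show ?thesis using vector_derivative_at[OF 1] vector_derivative_at[OF 2] by simp
qed

lemma SODE_on_fst:
  assumes "SODE_on Q M \<Gamma>" "y \<in> M"
  shows "fst (snd (\<Gamma> y) i) = snd y i"
proof -
  have "vertical_endomorphism (\<Gamma> y) = liouville_field y" using assms by (simp add: SODE_on_def)
  then show ?thesis unfolding vertical_endomorphism_def liouville_field_def by (metis prod.inject)
qed

lemma SODE_on_representative:
  assumes Q: "smooth_atlas (TB Q)" and \<Gamma>: "SODE_on Q M \<Gamma>" and W: "openin (mtopology (TB Q)) W"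
    and y: "y \<in> M \<inter> W"
  obtains g where "germ_curve_in (TB Q) (M \<inter> W) g" "g 0 = y" "velocity (TB Q) g 0 = \<Gamma> y"
proof -
  have "\<Gamma> y \<in> tangent_space (TB Q) M y" using \<Gamma> y by (simp add: SODE_on_def vector_field_on_def)
  then obtain g where g: "germ_curve_in (TB Q) M g" "g 0 = y" "velocity (TB Q) g 0 = \<Gamma> y"
    by (auto simp: tangent_space_def)
  then show thesis using germ_curve_in_open[OF Q g(1) _ W] y by (intro that) auto
qed

text \<open>The Tulczyjew map moves the \<open>dq\<close> part of \<open>TF (\<Gamma> y)\<close>
  into the base point. Since \<open>F\<close> covers the identity this part is that of
  \<open>\<Gamma> y\<close>, and by the SODE condition it is the fibre part of \<open>y\<close>, so
  the base point is \<open>y\<close> again. The last claim takes the covector transformation law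
  from the inclusion in \<open>carrier (CB (TB Q))\<close>, which the application obtains from the
  image being a submanifold.\<close>

lemma mu_section:
  fixes Q :: "('a, 'i, 'e::euclidean_space) atlas"
  assumes Q: "smooth_atlas (TB Q)" and \<Gamma>: "SODE_on Q M \<Gamma>" and W: "openin (mtopology (TB Q)) W"
    and M: "M \<subseteq> carrier (TB Q)"
    and F: "smooth_map_on (TB Q) (M \<inter> W) (CB Q) F" and base: "\<And>y. y \<in> M \<inter> W \<Longrightarrow> fst (F y) = fst y"
  defines "w \<equiv> \<lambda>y. snd (tangent_map (TB Q) (M \<inter> W) (CB Q) F (\<Gamma> y))"
  shows "y \<in> M \<inter> W \<Longrightarrow> tangent_map (TB Q) (M \<inter> W) (CB Q) F (\<Gamma> y) = (F y, w y)"
    and "y \<in> M \<inter> W \<Longrightarrow> fst (w y i) = snd y i"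
    and "y \<in> M \<inter> W \<Longrightarrow> mu Q (M \<inter> W) \<Gamma> F y = (y, \<lambda>i. (snd (w y i), snd (F y) i))"
    and "mu Q (M \<inter> W) \<Gamma> F ` (M \<inter> W) \<subseteq> carrier (CB (TB Q)) \<Longrightarrow>
      smooth_map_on (TB Q) (M \<inter> W) (CB (TB Q)) (\<lambda>y. (y, \<lambda>i. (snd (w y i), snd (F y) i)))"
proof -
  let ?X = "M \<inter> W"
  let ?TF = "tangent_map (TB Q) ?X (CB Q) F"
  have F_carrier: "F y \<in> carrier (CB Q)" if "y \<in> ?X" for y
    using F that by (auto simp: smooth_map_on_def)
  have rep: "\<exists>J g. 0 \<in> J \<and> smooth_curve (TB Q) J g \<and> g ` J \<subseteq> ?X \<and> g 0 = y \<and>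
      velocity (TB Q) g 0 = \<Gamma> y \<and> ?TF (\<Gamma> y) = velocity (CB Q) (F \<circ> g) 0" if y: "y \<in> ?X" for y
  proof -
    obtain g where g: "germ_curve_in (TB Q) ?X g" "g 0 = y" "velocity (TB Q) g 0 = \<Gamma> y"
      using SODE_on_representative[OF Q \<Gamma> W y] .
    then show ?thesis
      using tangent_map_velocity[OF F g(1)] unfolding germ_curve_in_def
      by (metis greaterThanLessThan_iff neg_less_0_iff_less)
  qed
  show TF: "?TF (\<Gamma> y) = (F y, w y)" if y: "y \<in> ?X" for y
  proof -
    obtain J g where "g 0 = y" "?TF (\<Gamma> y) = velocity (CB Q) (F \<circ> g) 0" using rep[OF y] by blast
    then show ?thesis by (intro prod_eqI) (simp_all add: w_def)
  qed
  show fst_w: "fst (w y i) = snd y i" if y: "y \<in> ?X" for y i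
  proof -
    obtain J g where g: "0 \<in> J" "smooth_curve (TB Q) J g" "g ` J \<subseteq> ?X" "g 0 = y"
      "velocity (TB Q) g 0 = \<Gamma> y" "?TF (\<Gamma> y) = velocity (CB Q) (F \<circ> g) 0" using rep[OF y] by blast
    show ?thesis
    proof (cases "fst y \<in> cdom Q i")
      case True
      then show ?thesis
        using velocity_fibre_map[OF F base g(2,3,1), of i] g SODE_on_fst[OF \<Gamma>, of y i] y
        by (simp add: w_def)
    next
      case False
      then have "(F \<circ> g) 0 \<notin> cdom (CB Q) i"
        using F_carrier[OF y] base[OF y] g(4) by (simp add: carrier_CB_cdom_iff)
      \<comment> \<open>Outside the chart the two sides agree because velocities and tangent vectors
        have the same default value 0.\<close>
      then have "w y i = 0" by (simp add: w_def g(6) snd_velocity_notin)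
      moreover have "snd y i = 0"
      proof -
        have "y \<in> carrier (TB Q)" using M y by blast
        then obtain k where "y \<in> cdom (TB Q) k" unfolding carrier_iff by blast
        then show ?thesis using False by (cases y) (auto simp: tangent_vectors_def)
      qed
      ultimately show ?thesis by simp
    qed
  qed
  show mu: "mu Q ?X \<Gamma> F y = (y, \<lambda>i. (snd (w y i), snd (F y) i))" if y: "y \<in> ?X" for y
  proof -
    have "mu Q ?X \<Gamma> F y = tulczyjew (F y, w y)" by (simp add: mu_def TF[OF y])
    also have "\<dots> = ((fst (F y), \<lambda>i. fst (w y i)), \<lambda>i. (snd (w y i), snd (F y) i))"
      by (simp add: tulczyjew_def split_beta)
    finally show ?thesis by (simp add: base[OF y] fst_w[OF y])
  qed
  assume mu_carrier: "mu Q ?X \<Gamma> F ` ?X \<subseteq> carrier (CB (TB Q))"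
  have \<sigma>: "(y, \<lambda>i. (snd (w y i), snd (F y) i)) \<in> carrier (CB (TB Q))" if "y \<in> ?X" for y
    using subsetD[OF mu_carrier imageI[OF that]] unfolding mu[OF that] .
  show "smooth_map_on (TB Q) ?X (CB (TB Q)) (\<lambda>y. (y, \<lambda>i. (snd (w y i), snd (F y) i)))"
    unfolding smooth_map_on_def
  proof (intro conjI ballI allI impI)
    show "(\<lambda>y. (y, \<lambda>i. (snd (w y i), snd (F y) i))) ` ?X \<subseteq> carrier (CB (TB Q))"
      using \<sigma> by blast
  next
    fix y i j assume y: "y \<in> ?X" and i: "y \<in> cdom (TB Q) i"
      and "(y, \<lambda>i. (snd (w y i), snd (F y) i)) \<in> cdom (CB (TB Q)) j"
    then have j: "y \<in> cdom (TB Q) j" by simp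
    then have "F y \<in> cdom (CB Q) j"
      using base[OF y] F_carrier[OF y] by (cases y) (simp add: carrier_CB_cdom_iff)
    then obtain V G where G: "open V" "chart (TB Q) i y \<in> V" "V \<subseteq> chart (TB Q) i ` cdom (TB Q) i" "smooth_on V G"
      "\<And>z. z \<in> ?X \<Longrightarrow> z \<in> cdom (TB Q) i \<Longrightarrow> chart (TB Q) i z \<in> V \<Longrightarrow>
        F z \<in> cdom (CB Q) j \<and> chart (CB Q) j (F z) = G (chart (TB Q) i z)"
      using smooth_map_onE[OF F y i] by metis
    have \<Gamma>_smooth: "smooth_map_on (TB Q) M (TB (TB Q)) \<Gamma>"
      using \<Gamma> by (simp add: SODE_on_def vector_field_on_def)
    have fst_\<Gamma>: "fst (\<Gamma> y) = y" using rep[OF y] by (metis fst_velocity)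
    have yM: "y \<in> M" using y by blast
    have "\<Gamma> y \<in> carrier (TB (TB Q))" using \<Gamma>_smooth yM by (auto simp: smooth_map_on_def)
    then have "\<Gamma> y \<in> cdom (TB (TB Q)) i" using fst_\<Gamma> i by (simp add: carrier_TB_cdom_iff)
    then obtain V' h where h: "open V'" "chart (TB Q) i y \<in> V'" "smooth_on V' h"
      "\<And>z. z \<in> M \<Longrightarrow> z \<in> cdom (TB Q) i \<Longrightarrow> chart (TB Q) i z \<in> V' \<Longrightarrow>
        \<Gamma> z \<in> cdom (TB (TB Q)) i \<and> chart (TB (TB Q)) i (\<Gamma> z) = h (chart (TB Q) i z)"
      using smooth_map_onE[OF \<Gamma>_smooth yM i] by metis
    \<comment> \<open>The coordinate form of \<open>TF \<circ> \<Gamma>\<close>: \<open>G\<close>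
      extends \<open>F\<close> from chart \<open>i\<close> to chart \<open>j\<close>, and
      \<open>snd (h z)\<close> is the vector part of \<Gamma> in chart \<open>i\<close>.\<close>
    define D where "D z = frechet_derivative G (at z) (snd (h z))" for z
    have VV: "open (V \<inter> V')" using G h by blast
    have sG: "smooth_on (V \<inter> V') G" and sh: "smooth_on (V \<inter> V') h"
      using smooth_on_subset[OF G(4)] smooth_on_subset[OF h(3)] by auto
    have sD: "smooth_on (V \<inter> V') D"
      unfolding D_def
      by (rule smooth_on_frechet_derivative_apply[OF VV VV sG smooth_on_linear_compose[OF VV bounded_linear_snd sh]
            smooth_on_bounded_linear[OF VV bounded_linear_ident]]) auto
    show "\<exists>V g. open V \<and> chart (TB Q) i y \<in> V \<and> V \<subseteq> chart (TB Q) i ` cdom (TB Q) i \<and> smooth_on V g \<and>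
      (\<forall>z\<in>?X \<inter> cdom (TB Q) i. chart (TB Q) i z \<in> V \<longrightarrow>
         (z, \<lambda>i. (snd (w z i), snd (F z) i)) \<in> cdom (CB (TB Q)) j \<and>
         chart (CB (TB Q)) j (z, \<lambda>i. (snd (w z i), snd (F z) i)) = g (chart (TB Q) i z))"
    \<comment> \<open>With \<open>G = (q, p)\<close> and \<open>D = (dq, dp)\<close> in chart
      \<open>j\<close>, the witness is the reordering \<open>((q, dq), (dp, p))\<close>;
      \<open>fst D\<close> is the fibre coordinate by the second claim.\<close>
    proof (intro exI[of _ "V \<inter> V'"] exI[of _ "\<lambda>z. ((fst (G z), fst (D z)), (snd (D z), snd (G z)))"] conjI ballI impI)
      show "open (V \<inter> V')" by (rule VV)
      show "chart (TB Q) i y \<in> V \<inter> V'" using G h by blast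
      show "V \<inter> V' \<subseteq> chart (TB Q) i ` cdom (TB Q) i" using G by blast
      show "smooth_on (V \<inter> V') (\<lambda>z. ((fst (G z), fst (D z)), (snd (D z), snd (G z))))"
        by (intro smooth_on_Pair VV smooth_on_linear_compose[OF VV bounded_linear_fst]
            smooth_on_linear_compose[OF VV bounded_linear_snd] sG sD)
      fix z assume z: "z \<in> ?X \<inter> cdom (TB Q) i" "chart (TB Q) i z \<in> V \<inter> V'"
      then have zX: "z \<in> ?X" and zi: "z \<in> cdom (TB Q) i" by auto
      have Fz: "F z \<in> cdom (CB Q) j" "chart (CB Q) j (F z) = G (chart (TB Q) i z)"
        using G(5)[OF zX zi] z(2) by auto
      have "fst z \<in> cdom Q j" using Fz(1) base[OF zX] by (cases "F z") simp
      then have zj: "z \<in> cdom (TB Q) j" using zX carrier_TB_cdom_iff[of z Q j] M by blast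
      then show "(z, \<lambda>i. (snd (w z i), snd (F z) i)) \<in> cdom (CB (TB Q)) j"
        using carrier_CB_cdom_iff[OF \<sigma>[OF zX], of j] unfolding fst_conv by blast
      obtain J g where g: "0 \<in> J" "smooth_curve (TB Q) J g" "g ` J \<subseteq> ?X" "g 0 = z"
        "velocity (TB Q) g 0 = \<Gamma> z" "?TF (\<Gamma> z) = velocity (CB Q) (F \<circ> g) 0" using rep[OF zX] by blast
      have "chart (TB (TB Q)) i (\<Gamma> z) = h (chart (TB Q) i z)" using h(4) z by blast
      then have "snd (\<Gamma> z) i = snd (h (chart (TB Q) i z))" by (metis chart_TB_eq snd_conv)
      moreover have "snd (velocity (CB Q) (F \<circ> g) 0) j =
          frechet_derivative G (at (chart (TB Q) i (g 0))) (snd (velocity (TB Q) g 0) i)"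
        by (rule smooth_map_velocity[OF g(2,3,1) _ G(1) _ G(4,5)]) (use g(4) zi z(2) in auto)
      ultimately have "w z j = D (chart (TB Q) i z)"
        by (simp add: w_def g(4,5,6) D_def)
      then show "chart (CB (TB Q)) j (z, \<lambda>i. (snd (w z i), snd (F z) i)) =
          ((fst (G (chart (TB Q) i z)), fst (D (chart (TB Q) i z))), (snd (D (chart (TB Q) i z)), snd (G (chart (TB Q) i z))))"
        using Fz(2)[symmetric] fst_w[OF zX, of j] base[OF zX] by (simp add: chart_TB_eq chart_CB_eq)
    qed
  qed
qed

text \<open>The equations involve \<open>dL\<close> only along the velocity curve. \<eta> stands for
  the derivatives of \<open>L\<close> by positions and \<zeta> for those by velocities, so they
  become \<open>\<zeta>' = \<eta>\<close> in each chart.\<close>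

lemma euler_lagrange_iff:
  fixes Q :: "('a, 'i, 'e::euclidean_space) atlas"
  assumes c: "smooth_curve Q J c"
    and L: "\<And>t i. t \<in> J \<Longrightarrow> c t \<in> cdom Q i \<Longrightarrow>
      ((L \<circ> chart_inv (TB Q) i) has_derivative (\<lambda>w. (\<eta> t i, \<zeta> t i) \<bullet> w)) (at (chart (TB Q) i (velocity Q c t)))"
  shows "euler_lagrange Q L J c \<longleftrightarrow>
    (\<forall>t\<in>J. \<forall>i. c t \<in> cdom Q i \<longrightarrow> ((\<lambda>s. \<zeta> s i) has_vector_derivative \<eta> t i) (at t))"
proof -
  have "(\<forall>b\<in>Basis. ((\<lambda>s. frechet_derivative (L \<circ> chart_inv (TB Q) i) (at (chart (TB Q) i (velocity Q c s))) (0, b))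
      has_real_derivative frechet_derivative (L \<circ> chart_inv (TB Q) i) (at (chart (TB Q) i (velocity Q c t))) (b, 0)) (at t))
    \<longleftrightarrow> ((\<lambda>s. \<zeta> s i) has_vector_derivative \<eta> t i) (at t)" if t: "t \<in> J" "c t \<in> cdom Q i" for t i
  proof -
    \<comment> \<open>The formula for \<open>dL\<close> in chart \<open>i\<close> holds only while
      \<open>c\<close> stays in that chart; \<open>?J\<close> is the open set of times on which the
      differentiated functions may be exchanged.\<close>
    let ?J = "{t\<in>J. c t \<in> cdom Q i}"
    have J: "open ?J" "t \<in> ?J" using smooth_curveD(2)[OF c] t by auto
    have dL: "frechet_derivative (L \<circ> chart_inv (TB Q) i) (at (chart (TB Q) i (velocity Q c s))) (u, v) =
        \<eta> s i \<bullet> u + \<zeta> s i \<bullet> v" if "s \<in> ?J" for s u v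
      using frechet_derivative_eq[OF L[of s i]] that by simp
    have "((\<lambda>s. frechet_derivative (L \<circ> chart_inv (TB Q) i) (at (chart (TB Q) i (velocity Q c s))) (0, b))
        has_real_derivative d) (at t) \<longleftrightarrow> ((\<lambda>s. \<zeta> s i \<bullet> b) has_real_derivative d) (at t)" for b d
    proof
      assume "((\<lambda>s. frechet_derivative (L \<circ> chart_inv (TB Q) i) (at (chart (TB Q) i (velocity Q c s))) (0, b))
        has_real_derivative d) (at t)"
      then show "((\<lambda>s. \<zeta> s i \<bullet> b) has_real_derivative d) (at t)"
        by (rule has_field_derivative_transform_within_open[OF _ J]) (simp add: dL)
    next
      assume "((\<lambda>s. \<zeta> s i \<bullet> b) has_real_derivative d) (at t)"
      then show "((\<lambda>s. frechet_derivative (L \<circ> chart_inv (TB Q) i) (at (chart (TB Q) i (velocity Q c s))) (0, b))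
        has_real_derivative d) (at t)"
        by (rule has_field_derivative_transform_within_open[OF _ J]) (simp add: dL)
    qed
    then show ?thesis
      unfolding has_vector_derivative_def has_derivative_componentwise_within[of "\<lambda>s. \<zeta> s i"]
      by (simp add: dL[OF J(2)] has_field_derivative_def mult.commute[of _ "_ \<bullet> _"])
  qed
  then show ?thesis unfolding euler_lagrange_def Let_def by blast
qed

text \<open>Injectivity of \<open>TF\<close> on the tangent space transfers the comparison to
  \<open>TT\<^sup>*Q\<close>. There the base points and the \<open>dq\<close> parts agree
  automatically, so only the \<open>dp\<close> parts remain, and on the curve side these are the
  time derivatives of the momenta \<open>snd (F (C s))\<close>.\<close>

lemma velocity_eq_iff_immersion:
  fixes Q :: "('a, 'i, 'e::euclidean_space) atlas"
  assumes Q: "smooth_atlas (TB Q)" and \<Gamma>: "SODE_on Q M \<Gamma>" and W: "openin (mtopology (TB Q)) W"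
    and M: "M \<subseteq> carrier (TB Q)"
    and F: "immersion_on (TB Q) (M \<inter> W) (CB Q) F" and base: "\<And>y. y \<in> M \<inter> W \<Longrightarrow> fst (F y) = fst y"
    and c: "smooth_curve Q J c" "open J" "velocity Q c ` J \<subseteq> M \<inter> W" and t: "t \<in> J"
  defines "C \<equiv> velocity Q c"
  shows "velocity (TB Q) C t = \<Gamma> (C t) \<longleftrightarrow>
    (\<forall>i. c t \<in> cdom Q i \<longrightarrow> ((\<lambda>s. snd (F (C s)) i) has_vector_derivative
       snd (snd (tangent_map (TB Q) (M \<inter> W) (CB Q) F (\<Gamma> (C t))) i)) (at t))"
proof -
  let ?X = "M \<inter> W"
  let ?TF = "tangent_map (TB Q) ?X (CB Q) F"
  have F': "smooth_map_on (TB Q) ?X (CB Q) F" and inj: "\<And>y. y \<in> ?X \<Longrightarrow> inj_on ?TF (tangent_space (TB Q) ?X y)"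
    using F by (auto simp: immersion_on_def)
  note mu = mu_section[OF Q \<Gamma> W M F' base]
  have C_sub: "C ` J \<subseteq> ?X" and C_car: "velocity Q c ` J \<subseteq> carrier (TB Q)" using c(3) M by (auto simp: C_def)
  have C: "smooth_curve (TB Q) J C" unfolding C_def by (rule smooth_curve_velocity[OF c(1) C_car])
  have FC: "smooth_curve (CB Q) J (F \<circ> C)" by (rule smooth_curve_smooth_map[OF F' C C_sub])
  have Ct: "C t \<in> ?X" using C_sub t by blast
  have fstC: "fst (C s) = c s" for s by (simp add: C_def)
  have Fi: "(F \<circ> C) s \<in> cdom (CB Q) i \<longleftrightarrow> c s \<in> cdom Q i" if "s \<in> J" for s i
  proof -
    have "C s \<in> ?X" using C_sub that by blast
    then show ?thesis
      using base smooth_curveD(1)[OF FC that] by (simp add: carrier_CB_cdom_iff fstC)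
  qed
  have germ: "germ_curve_in (TB Q) ?X (\<lambda>s. C (t + s))"
    by (rule germ_curve_translate[OF C c(2) t C_sub])
  have vC: "velocity (TB Q) C t = velocity (TB Q) (\<lambda>s. C (t + s)) 0"
    by (rule velocity_translate[OF C t, symmetric])
  have TF_C: "?TF (velocity (TB Q) C t) = velocity (CB Q) (F \<circ> C) t"
    unfolding vC tangent_map_velocity[OF F' germ]
    using velocity_translate[OF FC t] by (simp add: o_def)
  have "velocity (TB Q) C t \<in> tangent_space (TB Q) ?X (C t)"
    unfolding vC tangent_space_def using germ by force
  moreover have "\<Gamma> (C t) \<in> tangent_space (TB Q) ?X (C t)"
  proof -
    obtain g where "germ_curve_in (TB Q) ?X g" "g 0 = C t" "velocity (TB Q) g 0 = \<Gamma> (C t)"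
      using SODE_on_representative[OF Q \<Gamma> W Ct] .
    then show ?thesis unfolding tangent_space_def by force
  qed
  ultimately have "velocity (TB Q) C t = \<Gamma> (C t) \<longleftrightarrow> velocity (CB Q) (F \<circ> C) t = ?TF (\<Gamma> (C t))"
    using inj_on_eq_iff[OF inj[OF Ct]] TF_C by metis
  also have "\<dots> \<longleftrightarrow> (\<forall>i. c t \<in> cdom Q i \<longrightarrow> snd (snd (velocity (CB Q) (F \<circ> C) t) i) = snd (snd (?TF (\<Gamma> (C t))) i))"
  proof
    assume *: "\<forall>i. c t \<in> cdom Q i \<longrightarrow> snd (snd (velocity (CB Q) (F \<circ> C) t) i) = snd (snd (?TF (\<Gamma> (C t))) i)"
    have "snd (velocity (CB Q) (F \<circ> C) t) i = snd (?TF (\<Gamma> (C t))) i" for i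
    proof (cases "c t \<in> cdom Q i")
      case True
      \<comment> \<open>The \<open>dq\<close> part of both vectors is the velocity of
        \<open>c\<close>: on the left because \<open>C\<close> is a velocity curve, on the right
        because \<Gamma> is a SODE.\<close>
      have "fst (snd (velocity (CB Q) (F \<circ> C) t) i) = fst (snd (velocity (TB Q) C t) i)"
        using True by (intro velocity_fibre_map[OF F' base C C_sub t]) (auto simp: fstC)
      also have "\<dots> = snd (C t) i"
        unfolding C_def by (rule velocity_velocity[OF c(1) C_car t True])
      also have "\<dots> = fst (snd (?TF (\<Gamma> (C t))) i)" using mu(2)[OF _ Ct] by simp
      finally show ?thesis using * True by (intro prod_eqI) auto
    next
      case False
      obtain g where g: "germ_curve_in (TB Q) ?X g" "g 0 = C t" "velocity (TB Q) g 0 = \<Gamma> (C t)"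
        using SODE_on_representative[OF Q \<Gamma> W Ct] .
      have "(F \<circ> C) t \<notin> cdom (CB Q) i" "(F \<circ> g) 0 \<notin> cdom (CB Q) i" using False Fi[OF t, of i] g(2) by auto
      then show ?thesis
        using tangent_map_velocity[OF F' g(1)] by (simp add: g(3) snd_velocity_notin)
    qed
    then show "velocity (CB Q) (F \<circ> C) t = ?TF (\<Gamma> (C t))"
      using arg_cong[OF mu(1)[OF _ Ct], of fst] by (intro prod_eqI ext) auto
  qed simp
  also have "\<dots> \<longleftrightarrow> (\<forall>i. c t \<in> cdom Q i \<longrightarrow> ((\<lambda>s. snd (F (C s)) i) has_vector_derivative
       snd (snd (?TF (\<Gamma> (C t))) i)) (at t))"
  proof -
    have "((\<lambda>s. snd (F (C s)) i) has_vector_derivative snd (snd (velocity (CB Q) (F \<circ> C) t) i)) (at t)"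
      if "c t \<in> cdom Q i" for i
      using bounded_linear.has_vector_derivative[OF bounded_linear_snd
          smooth_curve_has_vector_derivative[OF FC t, of i]] that Fi[OF t, of i]
      by (simp add: chart_CB_eq o_def)
    then show ?thesis using vector_derivative_at by metis
  qed
  finally show ?thesis .
qed

theorem theorem5p6:
  fixes Q :: "('a, 'i, 'e::euclidean_space) atlas"
    and m :: nat
    and M :: "('a \<times> ('i \<Rightarrow> 'e)) set"
    and \<Gamma> :: "'a \<times> ('i \<Rightarrow> 'e) \<Rightarrow> ('a \<times> ('i \<Rightarrow> 'e)) \<times> ('i \<Rightarrow> 'e \<times> 'e)"
  assumes "smooth_manifold Q"
    and "constraint_submanifold Q m M"
    and "SODE_on Q M \<Gamma>"
    and "variational Q M \<Gamma>"
  shows "\<forall>x\<in>M. \<exists>U L.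
           openin (mtopology (TB Q)) U \<and> x \<in> U \<and> smooth_function_on (TB Q) U L \<and>
           (\<forall>J c. open J \<and> is_interval J \<and> smooth_curve Q J c \<and> velocity Q c ` J \<subseteq> M \<inter> U \<longrightarrow>
              (integral_curve (TB Q) M \<Gamma> J (velocity Q c) \<longleftrightarrow> euler_lagrange Q L J c))"
proof
  fix x assume x: "x \<in> M"
  have N: "smooth_atlas (TB Q)"
    using assms(1) by (intro smooth_atlas_TB smooth_manifold_imp_smooth_atlas)
  have subm: "submanifold (TB Q) (2 * DIM('e) - m) M"
    using assms(2) by (simp add: constraint_submanifold_def)
  then have M: "M \<subseteq> carrier (TB Q)" by (simp add: submanifold_def)
  obtain W F where W: "openin (mtopology (TB Q)) W" "x \<in> W" and F: "immersion_on (TB Q) (M \<inter> W) (CB Q) F"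
    and base: "\<And>y. y \<in> M \<inter> W \<Longrightarrow> fst (F y) = fst y"
    and iso: "isotropic_submanifold (TB Q) (mu Q (M \<inter> W) \<Gamma> F ` (M \<inter> W))"
    using assms(4) x unfolding variational_def by metis
  have F': "smooth_map_on (TB Q) (M \<inter> W) (CB Q) F" using F by (simp add: immersion_on_def)
  let ?w = "\<lambda>y. snd (tangent_map (TB Q) (M \<inter> W) (CB Q) F (\<Gamma> y))"
  \<comment> \<open>In the order \<open>(dp, p)\<close> this pairs with \<open>(q, dq)\<close>
    directions, as the covector \<open>dp dq + p d(dq)\<close> requires.\<close>
  define \<theta> where "\<theta> = (\<lambda>y i. (snd (?w y i), snd (F y) i))"
  note mu = mu_section[OF N assms(3) W(1) M F' base, folded \<theta>_def]
  have "mu Q (M \<inter> W) \<Gamma> F ` (M \<inter> W) \<subseteq> carrier (CB (TB Q))"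
    using iso unfolding isotropic_submanifold_def submanifold_def by blast
  then have \<theta>_smooth: "smooth_map_on (TB Q) (M \<inter> W) (CB (TB Q)) (\<lambda>y. (y, \<theta> y))"
    unfolding \<theta>_def by (intro mu(4)) auto
  have "mu Q (M \<inter> W) \<Gamma> F ` (M \<inter> W) = (\<lambda>y. (y, \<theta> y)) ` (M \<inter> W)"
    unfolding \<theta>_def by (rule image_cong[OF refl mu(3)])
  with iso have "isotropic_submanifold (TB Q) ((\<lambda>y. (y, \<theta> y)) ` (M \<inter> W))" by simp
  note primitive = isotropic_section_primitive[OF N subm W(1) x W(2) \<theta>_smooth this]
  obtain U L where U: "openin (mtopology (TB Q)) U" "x \<in> U" "U \<subseteq> W" "smooth_function_on (TB Q) U L"
    and L: "\<And>y j. y \<in> M \<Longrightarrow> y \<in> U \<Longrightarrow> y \<in> cdom (TB Q) j \<Longrightarrow>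
      ((L \<circ> chart_inv (TB Q) j) has_derivative (\<lambda>w. \<theta> y j \<bullet> w)) (at (chart (TB Q) j y))"
    using primitive by blast
  have "integral_curve (TB Q) M \<Gamma> J (velocity Q c) \<longleftrightarrow> euler_lagrange Q L J c"
    if c: "open J" "smooth_curve Q J c" "velocity Q c ` J \<subseteq> M \<inter> U" for J c
  proof -
    let ?C = "velocity Q c"
    have C: "?C ` J \<subseteq> M \<inter> W" "?C ` J \<subseteq> carrier (TB Q)" using c(3) U(3) M by auto
    have "integral_curve (TB Q) M \<Gamma> J ?C \<longleftrightarrow> (\<forall>t\<in>J. velocity (TB Q) ?C t = \<Gamma> (?C t))"
      using smooth_curve_velocity[OF c(2) C(2)] C(1) by (auto simp: integral_curve_def)
    also have "\<dots> \<longleftrightarrow> (\<forall>t\<in>J. \<forall>i. c t \<in> cdom Q i \<longrightarrow>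
        ((\<lambda>s. snd (F (?C s)) i) has_vector_derivative snd (?w (?C t) i)) (at t))"
      using velocity_eq_iff_immersion[OF N assms(3) W(1) M F base c(2,1) C(1)] by blast
    also have "\<dots> \<longleftrightarrow> euler_lagrange Q L J c"
    \<comment> \<open>Applied with the \<open>dp\<close> part of \<open>TF \<circ> \<Gamma>\<close>
      as \<eta> and the momentum of \<open>F\<close> as \<zeta>; both are read along the velocity
      curve of \<open>c\<close>.\<close>
    proof (rule euler_lagrange_iff[OF c(2), symmetric])
      fix t i assume t: "t \<in> J" "c t \<in> cdom Q i"
      then have "?C t \<in> M" "?C t \<in> U" "?C t \<in> carrier (TB Q)" using c(3) C(2) by auto
      then show "((L \<circ> chart_inv (TB Q) i) has_derivative (\<lambda>w. (snd (?w (?C t) i), snd (F (?C t)) i) \<bullet> w))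
          (at (chart (TB Q) i (?C t)))"
        using L[of "?C t" i] t(2) by (simp add: carrier_TB_cdom_iff \<theta>_def)
    qed
    finally show ?thesis .
  qed
  with U show "\<exists>U L. openin (mtopology (TB Q)) U \<and> x \<in> U \<and> smooth_function_on (TB Q) U L \<and>
      (\<forall>J c. open J \<and> is_interval J \<and> smooth_curve Q J c \<and> velocity Q c ` J \<subseteq> M \<inter> U \<longrightarrow>
         (integral_curve (TB Q) M \<Gamma> J (velocity Q c) \<longleftrightarrow> euler_lagrange Q L J c))"
    by blast
qed

end
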